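(* Assume that the weights $\mathbf W$ satisfy Conditions 1 (given in the context). There exist constants $A>0$ and $\bar A>A$ such that, for any $(m,y)=(m(n),y(n))$, $m$ integer-valued, satisfying Conditions 2 (given in the context) with constant $\bar A$, we have for all $n$ large enough $$\mathbb P\left[\sup_{0\le i\le j\le m}\left|\sum_{k=i}^j w_{v(k)}-\mathbb E\left[\sum_{k=i}^j w_{v(k)}\right]\right|\ge y\right]\le A\exp\left(\frac{-y^2}{A(yn^{1/3}+m)}\right).$$
   Context: Weights. For each $n\ge1$, $\mathbf W=(w_1,\dots,w_n)$ is a deterministic vector of weights (depending implicitly on $n$) with $0<w_n\le w_{n-1}\le\dots\le w_1$, and $\ell_n=\sum_{i=1}^n w_i$. Conditions 1. There is a positive random variable $W$ such that: (i) the distribution of a uniformly chosen weight (uniform among $w_1,\dots,w_n$) converges weakly to $W$ as $n\to\infty$; (ii) $\mathbb E[W^3]<\infty$; (iii) $\mathbb E[W^2]=\mathbb E[W]$; (iv) $\ell_n=\mathbb E[W]n+o(n^{2/3})$; (v) $\sum_{k=1}^n w_k^2=\mathbb E[W^2]n+o(n^{2/3})$; (vi) $\sum_{k=1}^n w_k^3=\mathbb E[W^3]n+o(1)$; (vii) $\max_{i\le n}w_i=o(n^{1/3})$. Size-biased sampling without replacement. $(v(1),\dots,v(n))$ is the random permutation of $\{1,\dots,n\}$ with $\mathbb P(v(1)=j)=w_j/\ell_n$ and $\mathbb P(v(i+1)=j\mid v(1),\dots,v(i))=\dfrac{w_j\mathbf 1(j\notin\{v(1),\dots,v(i)\})}{\ell_n-\sum_{k=1}^i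 w_{v(k)}}$. By convention $w_{v(0)}=0$. Conditions 2 (with constant $\bar A$). A pair of positive sequences $(a(n),b(n))$ satisfies Conditions 2 if: for all $n$ large enough $\exp\left(\frac{-b(n)^2}{\bar A(b(n)n^{1/3}+a(n))}\right)<1/4$; $\lim_n a(n)=\lim_n b(n)=+\infty$; $a(n)=o(n)$; $b(n)=O(a(n))$; $a(n)=O(b(n)\ell_n^{1/3})$; and $a(n)^2=O(b(n)\ell_n)$. (In the paper $\bar A$ is a fixed constant independent of $n$, larger than all the other constants $A,A',\dots$ appearing.) *)

theory Defs
  imports "HOL-Probability.Probability" "HOL-Library.Landau_Symbols"
begin

(* A weight array is w :: nat => nat => real, where w n i is the i-th weight of the vector
   of length n; only the entries with 1 <= i <= n are meaningful. *)

definition weights :: "(nat \<Rightarrow> nat \<Rightarrow> real) \<Rightarrow> bool" where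
  "weights w \<longleftrightarrow>
     (\<forall>n\<ge>1. (\<forall>i\<in>{1..n}. 0 < w n i) \<and> (\<forall>i\<in>{1..<n}. w n (i + 1) \<le> w n i))"

definition total_weight :: "(nat \<Rightarrow> nat \<Rightarrow> real) \<Rightarrow> nat \<Rightarrow> real" where
  "total_weight w n = (\<Sum>i=1..n. w n i)"

(* W is a random variable on the probability space N. Since W is positive, the finiteness of
   its third moment is integrability of W^3; the lower moments are then finite as well. *)

definition conditions1 ::
  "(nat \<Rightarrow> nat \<Rightarrow> real) \<Rightarrow> 'b measure \<Rightarrow> ('b \<Rightarrow> real) \<Rightarrow> bool" where
  "conditions1 w N W \<longleftrightarrow>
     prob_space N \<and> W \<in> borel_measurable N \<and> (AE x in N. 0 < W x) \<and>
     weak_conv_m (\<lambda>n. distr (measure_pmf (pmf_of_set {1..n})) borel (w n)) (distr N borel W) \<and>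
     integrable N (\<lambda>x. W x ^ 3) \<and>
     (\<integral>x. W x ^ 2 \<partial>N) = (\<integral>x. W x \<partial>N) \<and>
     (\<lambda>n. total_weight w n - (\<integral>x. W x \<partial>N) * real n) \<in> o(\<lambda>n. real n powr (2/3)) \<and>
     (\<lambda>n. (\<Sum>k=1..n. w n k ^ 2) - (\<integral>x. W x ^ 2 \<partial>N) * real n) \<in> o(\<lambda>n. real n powr (2/3)) \<and>
     (\<lambda>n. (\<Sum>k=1..n. w n k ^ 3) - (\<integral>x. W x ^ 3 \<partial>N) * real n) \<in> o(\<lambda>n. 1) \<and>
     (\<lambda>n. Max (w n ` {1..n})) \<in> o(\<lambda>n. real n powr (1/3))"

(* v k is the k-th sampled index. The conditional law of v (i + 1) is prescribed for every
   history x 1, ..., x i of positive probability. *)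

definition size_biased_permutation ::
  "'a measure \<Rightarrow> (nat \<Rightarrow> real) \<Rightarrow> nat \<Rightarrow> (nat \<Rightarrow> 'a \<Rightarrow> nat) \<Rightarrow> bool" where
  "size_biased_permutation M u n v \<longleftrightarrow>
     prob_space M \<and>
     (\<forall>k\<in>{1..n}. v k \<in> measurable M (count_space UNIV)) \<and>
     (\<forall>\<omega>\<in>space M. bij_betw (\<lambda>k. v k \<omega>) {1..n} {1..n}) \<and>
     (\<forall>j\<in>{1..n}. \<P>(\<omega> in M. v 1 \<omega> = j) = u j / (\<Sum>k=1..n. u k)) \<and>
     (\<forall>i\<in>{1..<n}. \<forall>x :: nat \<Rightarrow> nat. \<forall>j\<in>{1..n}.
        \<P>(\<omega> in M. \<forall>k\<in>{1..i}. v k \<omega> = x k) > 0 \<longrightarrow>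
        \<P>(\<omega> in M. v (i + 1) \<omega> = j \<bar> \<forall>k\<in>{1..i}. v k \<omega> = x k) =
          u j * (if j \<notin> x ` {1..i} then 1 else 0) / ((\<Sum>k=1..n. u k) - (\<Sum>k=1..i. u (x k))))"

(* The weight of the k-th sampled index, with the convention that the weight at step 0 is 0. *)

definition sampled_weight :: "(nat \<Rightarrow> real) \<Rightarrow> (nat \<Rightarrow> 'a \<Rightarrow> nat) \<Rightarrow> nat \<Rightarrow> 'a \<Rightarrow> real" where
  "sampled_weight u v k \<omega> = (if k = 0 then 0 else u (v k \<omega>))"

definition conditions2 ::
  "(nat \<Rightarrow> nat \<Rightarrow> real) \<Rightarrow> real \<Rightarrow> (nat \<Rightarrow> real) \<Rightarrow> (nat \<Rightarrow> real) \<Rightarrow> bool" where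
  "conditions2 w Abar a b \<longleftrightarrow>
     (\<forall>n\<ge>1. 0 < a n \<and> 0 < b n) \<and>
     (\<forall>\<^sub>F n in sequentially.
        exp (- (b n)\<^sup>2 / (Abar * (b n * real n powr (1/3) + a n))) < 1/4) \<and>
     filterlim a at_top sequentially \<and>
     filterlim b at_top sequentially \<and>
     a \<in> o(\<lambda>n. real n) \<and>
     b \<in> O(a) \<and>
     a \<in> O(\<lambda>n. b n * total_weight w n powr (1/3)) \<and>
     (\<lambda>n. (a n)\<^sup>2) \<in> O(\<lambda>n. b n * total_weight w n)"

end

(* Write S_k, T_k for the sums of the first k sampled weights and of their squares, and l, q, r for
   the first three power sums of all weights. The compensator of S_k is the sum over i < k of
   (q - T_i) / (l - S_i), and a Freedman inequality (e^z <= 1 + z + z^2 together with the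
   supermartingale stopped on first passage) controls the martingale part, with variance O(m) and
   jumps at most n^(1/3). The compensator is compared with the deterministic sum over i < k of
   (q - r i / l) / (l - q i / l). As m = o(n) and the cubes of the weights are uniformly integrable,
   S_i - q i / l and T_i - r i / l are the corresponding martingales up to o(m), and since
   m^2 = O(y n) an error o(m) there moves the compensator by only o(y). The fluctuations of T_i are
   controlled by Freedman again after truncating at weights n / m, which keeps its jumps small and
   costs o(m). The bias of the expectation follows from first moments of the same martingales and
   is at most a small multiple of y because a large constant in Conditions 2 makes y large compared
   with n^(1/3) + sqrt m. *)

theory Submission
  imports Defs
begin

section \<open>Histories of draws, their drift and the one-step exponential bound\<close>

text \<open>Histories are lists with the most recent draw first.\<close>

definition drawn :: "(nat \<Rightarrow> 'a \<Rightarrow> nat) \<Rightarrow> nat \<Rightarrow> 'a \<Rightarrow> nat list" where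
  "drawn v k \<omega> = map (\<lambda>i. v i \<omega>) (rev [1..<Suc k])"

lemma drawn_0 [simp]: "drawn v 0 \<omega> = []"
  and drawn_Suc [simp]: "drawn v (Suc k) \<omega> = v (Suc k) \<omega> # drawn v k \<omega>"
  by (simp_all add: drawn_def)

lemma length_drawn [simp]: "length (drawn v k \<omega>) = k"
  by (simp add: drawn_def)

text \<open>The transition kernel of the sampling: the conditional law of the next index after
  history \<open>h\<close>. Being a function of the list alone, it allows drift estimates to be made
  pathwise.\<close>

definition draw :: "(nat \<Rightarrow> real) \<Rightarrow> nat \<Rightarrow> nat list \<Rightarrow> nat \<Rightarrow> real" where
  "draw u n h j =
     u j * (if j \<notin> set h then 1 else 0) / ((\<Sum>i=1..n. u i) - sum_list (map u h))"

text \<open>The predictable part of the Doob decomposition of the sum of \<open>g\<close> along the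
  history. The newest draw \<open>j\<close> does not enter: its drift is computed from the history
  \<open>h\<close> before it.\<close>

primrec compensator :: "(nat \<Rightarrow> real) \<Rightarrow> nat \<Rightarrow> (nat \<Rightarrow> real) \<Rightarrow> nat list \<Rightarrow> real" where
  "compensator u n g [] = 0"
| "compensator u n g (j # h) = compensator u n g h + (\<Sum>i=1..n. draw u n h i * g i)"

text \<open>The martingale part of the same decomposition.\<close>

definition excess :: "(nat \<Rightarrow> real) \<Rightarrow> nat \<Rightarrow> (nat \<Rightarrow> real) \<Rightarrow> nat list \<Rightarrow> real" where
  "excess u n g h = sum_list (map g h) - compensator u n g h"

lemma excess_Nil [simp]: "excess u n g [] = 0"
  by (simp add: excess_def)

lemma excess_Cons:
  "excess u n g (j # h) = excess u n g h + (g j - (\<Sum>i=1..n. draw u n h i * g i))"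
  by (simp add: excess_def)

definition admissible :: "nat \<Rightarrow> nat list \<Rightarrow> bool" where
  "admissible n h \<longleftrightarrow> distinct h \<and> set h \<subseteq> {1..n}"

lemma admissible_ConsD: "admissible n (j # h) \<Longrightarrow> admissible n h"
  by (simp add: admissible_def)

lemma admissible_sum_list: "admissible n h \<Longrightarrow> sum_list (map g h) = sum g (set h)"
  by (simp add: admissible_def sum_list_distinct_conv_sum_set)

text \<open>The indicator in \<open>draw\<close> deletes the drawn indices from numerator and
  denominator alike. When \<open>g\<close> is a power of \<open>u\<close>, the drift thus becomes a
  ratio of power sums of the remaining weights.\<close>

lemma sum_draw:
  assumes "admissible n h"
  shows "(\<Sum>i=1..n. draw u n h i * g i) =
    ((\<Sum>i=1..n. u i * g i) - sum_list (map (\<lambda>i. u i * g i) h)) /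
    ((\<Sum>i=1..n. u i) - sum_list (map u h))"
proof -
  have "(\<Sum>i=1..n. u i * (if i \<notin> set h then 1 else 0) * g i) =
      (\<Sum>i\<in>{1..n} - set h. u i * g i)"
    by (rule sum.mono_neutral_cong_right) auto
  also have "\<dots> = (\<Sum>i=1..n. u i * g i) - (\<Sum>i\<in>set h. u i * g i)"
    using assms by (intro sum_diff) (auto simp: admissible_def)
  finally show ?thesis
    using assms by (simp add: draw_def admissible_sum_list sum_divide_distrib[symmetric])
qed

lemma admissible_remaining_pos:
  assumes "admissible n h" "length h < n" "\<And>i. i \<in> {1..n} \<Longrightarrow> 0 < u i"
  shows "0 < (\<Sum>i=1..n. u i) - sum_list (map u h :: real list)"
proof -
  have "(\<Sum>i=1..n. u i) - sum_list (map u h) = sum u ({1..n} - set h)"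
    using assms(1) by (simp add: admissible_sum_list) (subst sum_diff, auto simp: admissible_def)
  moreover have "card (set h) < card {1..n}"
    using assms(1,2) by (simp add: admissible_def distinct_card)
  then have "{1..n} - set h \<noteq> {}"
    by (metis Diff_eq_empty_iff card_mono finite_set leD List.finite_set)
  ultimately show ?thesis
    using assms(3) by (auto intro!: sum_pos)
qed

text \<open>For \<open>z = - x\<close> negative the bound is a reciprocal one: the Taylor lower
  bound 1 + x + x^2/2 for exp x, multiplied by 1 - x + x^2, is at least 1.\<close>

lemma exp_le_quadratic:
  fixes z :: real
  assumes "\<bar>z\<bar> \<le> 1"
  shows "exp z \<le> 1 + z + z\<^sup>2"
proof (cases "z \<ge> 0")
  case True
  then show ?thesis using assms exp_bound[of z] by simp
next
  case False
  define x where "x = - z"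
  have x: "0 \<le> x" "x \<le> 1" using False assms by (auto simp: x_def)
  have "1 + x + x\<^sup>2 / 2 \<le> exp x"
    using exp_lower_Taylor_quadratic[of x] x by simp
  moreover have "(1 + x + x\<^sup>2 / 2) * (1 - x + x\<^sup>2) \<ge> 1"
  proof -
    have "(1 + x + x\<^sup>2 / 2) * (1 - x + x\<^sup>2) - 1 = x\<^sup>2 / 2 + x^3 / 2 + x^4 / 2"
      by (simp add: field_simps power2_eq_square power3_eq_cube power4_eq_xxxx)
    then show ?thesis using x by (smt (verit) zero_le_power divide_nonneg_nonneg)
  qed
  moreover have "0 < 1 - x + x\<^sup>2" using x
    by (smt (verit) power2_eq_square mult_le_one zero_less_power mult_nonneg_nonneg zero_less_mult_iff)
  ultimately have "1 \<le> exp x * (1 - x + x\<^sup>2)"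
    by (meson mult_right_mono order_less_imp_le order_trans)
  then have "exp (- x) \<le> 1 - x + x\<^sup>2"
    by (simp add: exp_minus field_simps)
  then show ?thesis by (simp add: x_def)
qed

text \<open>The mean is taken out as a separate factor before expanding, so the jump bound is needed
  only for \<open>g\<close>, not for its centered version, and the uncentered second moment
  suffices. The linear term then cancels.\<close>

lemma mgf_step:
  assumes h: "admissible n h" "length h < n" and pos: "\<And>i. i \<in> {1..n} \<Longrightarrow> 0 < u i"
    and G: "\<And>i. i \<in> {1..n} \<Longrightarrow> \<bar>g i\<bar> \<le> G" and l: "\<bar>l\<bar> * G \<le> 1"
    and V: "(\<Sum>i=1..n. draw u n h i * (g i)\<^sup>2) \<le> V"
  shows "(\<Sum>j=1..n. draw u n h j * exp (l * (g j - (\<Sum>i=1..n. draw u n h i * g i)))) \<le> exp (l\<^sup>2 * V)"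
proof -
  define c where "c = (\<Sum>i=1..n. draw u n h i * g i)"
  have rem: "0 < (\<Sum>i=1..n. u i) - sum_list (map u h)"
    using admissible_remaining_pos[OF h pos] by auto
  have nn: "0 \<le> draw u n h i" if "i \<in> {1..n}" for i
    using rem pos[OF that] by (simp add: draw_def)
  have one: "(\<Sum>i=1..n. draw u n h i) = 1"
    using sum_draw[OF h(1), of u "\<lambda>_. 1"] rem by simp
  have "(\<Sum>j=1..n. draw u n h j * exp (l * g j)) \<le>
      (\<Sum>j=1..n. draw u n h j * (1 + l * g j + (l * g j)\<^sup>2))"
  proof (intro sum_mono mult_left_mono nn exp_le_quadratic)
    fix j assume "j \<in> {1..n}"
    then have "\<bar>l\<bar> * \<bar>g j\<bar> \<le> \<bar>l\<bar> * G" by (intro mult_left_mono G) auto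
    then show "\<bar>l * g j\<bar> \<le> 1" using l by (simp add: abs_mult)
  qed
  also have "\<dots> = (\<Sum>i=1..n. draw u n h i) + l * c + l\<^sup>2 * (\<Sum>i=1..n. draw u n h i * (g i)\<^sup>2)"
    by (simp add: c_def sum_distrib_left sum.distrib[symmetric] algebra_simps power2_eq_square)
  also have "\<dots> \<le> 1 + (l * c + l\<^sup>2 * V)"
    using mult_left_mono[OF V, of "l\<^sup>2"] one by simp
  also have "\<dots> \<le> exp (l * c + l\<^sup>2 * V)" by (rule exp_ge_add_one_self)
  finally have "(\<Sum>j=1..n. draw u n h j * exp (l * g j)) * exp (- (l * c)) \<le> exp (l * c + l\<^sup>2 * V) * exp (- (l * c))"
    by (intro mult_right_mono) auto
  also have "\<dots> = exp (l\<^sup>2 * V)" by (simp add: exp_add[symmetric])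
  also have "(\<Sum>j=1..n. draw u n h j * exp (l * g j)) * exp (- (l * c)) =
      (\<Sum>j=1..n. draw u n h j * exp (l * (g j - c)))"
    by (simp add: sum_distrib_right mult.assoc exp_add[symmetric] right_diff_distrib)
  finally show ?thesis unfolding c_def .
qed

subsection \<open>Exponential supermartingales\<close>

locale size_biased_sampling = prob_space M
  for M :: "'a measure" and u :: "nat \<Rightarrow> real" and n :: nat and v :: "nat \<Rightarrow> 'a \<Rightarrow> nat" +
  assumes pos: "\<And>i. i \<in> {1..n} \<Longrightarrow> 0 < u i"
    and sampling: "size_biased_permutation M u n v"
begin

lemma admissible_drawn:
  assumes "\<omega> \<in> space M" "k \<le> n"
  shows "admissible n (drawn v k \<omega>)"
proof -
  have b: "bij_betw (\<lambda>k. v k \<omega>) {1..n} {1..n}"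
    using sampling assms(1) by (simp add: size_biased_permutation_def)
  have "inj_on (\<lambda>k. v k \<omega>) {1..k}"
    using b assms(2) by (meson bij_betw_imp_inj_on inj_on_subset atLeastatMost_subset_iff le_refl)
  moreover have "(\<lambda>k. v k \<omega>) ` {1..k} \<subseteq> {1..n}"
    using bij_betw_imp_surj_on[OF b] assms(2) by (metis atLeastatMost_subset_iff image_mono le_refl)
  moreover have "{1..<Suc k} = {1..k}" by auto
  ultimately show ?thesis
    by (simp add: admissible_def drawn_def distinct_map del: upt_Suc)
qed

lemma measurable_drawn [measurable]:
  assumes "k \<le> n"
  shows "drawn v k \<in> measurable M (count_space UNIV)"
  using assms
proof (induction k)
  case (Suc k)
  have 1: "v (Suc k) \<in> measurable M (count_space UNIV)"
    using sampling Suc.prems by (simp add: size_biased_permutation_def)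
  have 2: "drawn v k \<in> measurable M (count_space UNIV)"
    using Suc by simp
  have "(\<lambda>\<omega>. v (Suc k) \<omega> # drawn v k \<omega>) \<in> measurable M (count_space UNIV)"
    by (rule measurable_compose_countable[OF measurable_compose_countable[OF _ 1] 2]) simp
  then show ?case by (simp add: drawn_Suc[abs_def] fun_eq_iff cong: measurable_cong)
qed (simp add: drawn_def[abs_def])

text \<open>The newest draw is at the head, so draw \<open>i\<close> sits at the zero-based position
  \<open>k - i\<close>. This passes from lists to the form of history in which the sampling law is
  prescribed.\<close>

lemma drawn_eq_iff:
  assumes "length h = k"
  shows "drawn v k \<omega> = h \<longleftrightarrow> (\<forall>i\<in>{1..k}. v i \<omega> = h ! (k - i))"
proof -
  have "h = map (\<lambda>i. h ! (k - i)) (rev [1..<Suc k])"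
    using assms by (intro nth_equalityI) (auto simp: rev_nth simp del: upt_Suc)
  then have "drawn v k \<omega> = h \<longleftrightarrow> map (\<lambda>i. v i \<omega>) (rev [1..<Suc k]) = map (\<lambda>i. h ! (k - i)) (rev [1..<Suc k])"
    unfolding drawn_def by metis
  also have "\<dots> \<longleftrightarrow> (\<forall>i\<in>{1..k}. v i \<omega> = h ! (k - i))"
    unfolding map_eq_conv by (auto simp del: upt_Suc)
  finally show ?thesis .
qed

text \<open>For \<open>k = 0\<close> this is the law of the first draw, otherwise the prescribed
  conditional law. The latter is given only for histories of positive probability; for the others
  both sides vanish by monotonicity.\<close>

lemma prob_drawn_Cons:
  assumes "length h = k" "k < n" "j \<in> {1..n}"
  shows "\<P>(\<omega> in M. drawn v (Suc k) \<omega> = j # h) = \<P>(\<omega> in M. drawn v k \<omega> = h) * draw u n h j"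
proof (cases "k = 0")
  case True
  then show ?thesis
    using sampling assms by (simp add: size_biased_permutation_def draw_def prob_space)
next
  case False
  define x where "x i = h ! (k - i)" for i
  have bij: "bij_betw (\<lambda>i. k - i) {1..k} {..<k}"
    by (rule bij_betwI[where g = "\<lambda>i. k - i"]) auto
  have set: "x ` {1..k} = set h"
    using bij_betw_imp_surj_on[OF bij] assms(1) unfolding x_def
    by (metis (no_types, lifting) image_image set_conv_nth lessThan_iff Collect_cong image_cong
        nth_image[of k h] take_all order_refl lessThan_atLeast0)
  have sum: "(\<Sum>i=1..k. u (x i)) = sum_list (map u h)"
    using sum.reindex_bij_betw[OF bij, of "\<lambda>i. u (h ! i)"] assms(1)
    by (simp add: x_def sum_list_sum_nth lessThan_atLeast0)
  have eq: "drawn v k \<omega> = h \<longleftrightarrow> (\<forall>i\<in>{1..k}. v i \<omega> = x i)" for \<omega>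
    using drawn_eq_iff[OF assms(1)] by (simp add: x_def)
  have m: "{\<omega> \<in> space M. drawn v k \<omega> = h} \<in> events"
    using measurable_drawn[of k] assms(2) by simp measurable
  show ?thesis
  proof (cases "\<P>(\<omega> in M. drawn v k \<omega> = h) > 0")
    case True
    have "\<P>(\<omega> in M. v (k + 1) \<omega> = j \<bar> \<forall>i\<in>{1..k}. v i \<omega> = x i) =
        u j * (if j \<notin> x ` {1..k} then 1 else 0) / ((\<Sum>i=1..n. u i) - (\<Sum>i=1..k. u (x i)))"
      using sampling True assms False unfolding size_biased_permutation_def eq by auto
    then have "\<P>(\<omega> in M. v (k + 1) \<omega> = j \<bar> drawn v k \<omega> = h) = draw u n h j"
      by (simp only: eq set sum draw_def)
    then show ?thesis
      using True by (simp add: cond_prob_def field_simps)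
  next
    case False
    then have 0: "\<P>(\<omega> in M. drawn v k \<omega> = h) = 0"
      by (simp add: zero_less_measure_iff)
    have "\<P>(\<omega> in M. drawn v (Suc k) \<omega> = j # h) \<le> \<P>(\<omega> in M. drawn v k \<omega> = h)"
      by (intro finite_measure_mono m) auto
    with 0 show ?thesis by (simp add: measure_le_0_iff)
  qed
qed

abbreviation histories :: "nat \<Rightarrow> nat list set" where
  "histories k \<equiv> {h. set h \<subseteq> {1..n} \<and> length h = k}"

text \<open>Only finitely many histories of length \<open>k\<close> occur, so every function of the
  history is simple, and integrability and expectations reduce to finite sums.\<close>

lemma drawn_expand:
  fixes F :: "nat list \<Rightarrow> real"
  assumes "\<omega> \<in> space M" "k \<le> n"
  shows "F (drawn v k \<omega>) =
    (\<Sum>h\<in>histories k. F h * indicator {\<omega> \<in> space M. drawn v k \<omega> = h} \<omega>)"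
proof -
  have mem: "drawn v k \<omega> \<in> histories k"
    using admissible_drawn[OF assms] by (simp add: admissible_def)
  have fin: "finite (histories k)" by (intro finite_lists_length_eq) simp
  have "(\<Sum>h\<in>histories k. F h * indicator {\<omega> \<in> space M. drawn v k \<omega> = h} \<omega>) =
      (\<Sum>h\<in>histories k. if h = drawn v k \<omega> then F h else 0)"
    using assms(1) by (intro sum.cong) (auto simp: indicator_def)
  then show ?thesis using mem fin by simp
qed

lemma drawn_event [measurable]: "k \<le> n \<Longrightarrow> {\<omega> \<in> space M. P (drawn v k \<omega>)} \<in> events"
  using measurable_drawn[of k] by (simp add: measurable_count_space_eq2_countable) measurable

lemma
  fixes F :: "nat list \<Rightarrow> real"
  assumes "k \<le> n"
  shows integrable_drawn: "integrable M (\<lambda>\<omega>. F (drawn v k \<omega>))"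
    and expectation_drawn:
      "expectation (\<lambda>\<omega>. F (drawn v k \<omega>)) = (\<Sum>h\<in>histories k. F h * \<P>(\<omega> in M. drawn v k \<omega> = h))"
proof -
  have i: "integrable M (\<lambda>\<omega>. F h * indicator {\<omega> \<in> space M. drawn v k \<omega> = h} \<omega>)" for h
    using drawn_event[OF assms] by (intro integrable_mult_right) (simp add: emeasure_eq_measure)
  show "integrable M (\<lambda>\<omega>. F (drawn v k \<omega>))"
    by (subst Bochner_Integration.integrable_cong[OF refl drawn_expand[OF _ assms]])
      (simp, intro Bochner_Integration.integrable_sum i)
  have "expectation (\<lambda>\<omega>. F (drawn v k \<omega>)) =
      expectation (\<lambda>\<omega>. \<Sum>h\<in>histories k. F h * indicator {\<omega> \<in> space M. drawn v k \<omega> = h} \<omega>)"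
    by (intro Bochner_Integration.integral_cong refl drawn_expand assms)
  also have "\<dots> = (\<Sum>h\<in>histories k. F h * \<P>(\<omega> in M. drawn v k \<omega> = h))"
    using drawn_event[OF assms]
    by (subst Bochner_Integration.integral_sum[OF i]) (simp del: One_nat_def)
  finally show "expectation (\<lambda>\<omega>. F (drawn v k \<omega>)) = (\<Sum>h\<in>histories k. F h * \<P>(\<omega> in M. drawn v k \<omega> = h))" .
qed

text \<open>The tower property, obtained by splitting the finite sum over histories according to the
  last draw.\<close>

lemma expectation_drawn_Suc:
  fixes F :: "nat list \<Rightarrow> real"
  assumes "k < n"
  shows "expectation (\<lambda>\<omega>. F (drawn v (Suc k) \<omega>)) =
    expectation (\<lambda>\<omega>. \<Sum>j=1..n. draw u n (drawn v k \<omega>) j * F (j # drawn v k \<omega>))"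
proof -
  have eq: "histories (Suc k) = (\<lambda>(h, j). j # h) ` (histories k \<times> {1..n})"
    by (auto simp: length_Suc_conv image_iff simp del: One_nat_def)
  have inj: "inj_on (\<lambda>(h, j). j # h) (histories k \<times> {1..n})"
    by (auto simp: inj_on_def)
  have "expectation (\<lambda>\<omega>. F (drawn v (Suc k) \<omega>)) =
      (\<Sum>(h, j)\<in>histories k \<times> {1..n}. F (j # h) * \<P>(\<omega> in M. drawn v (Suc k) \<omega> = j # h))"
    using assms
    by (subst expectation_drawn)
      (simp, unfold eq sum.reindex[OF inj], simp add: case_prod_unfold del: drawn_Suc)
  also have "\<dots> = (\<Sum>(h, j)\<in>histories k \<times> {1..n}.
      F (j # h) * (\<P>(\<omega> in M. drawn v k \<omega> = h) * draw u n h j))"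
    using assms by (intro sum.cong refl) (auto simp: prob_drawn_Cons simp del: drawn_Suc)
  also have "\<dots> = (\<Sum>h\<in>histories k. (\<Sum>j=1..n. draw u n h j * F (j # h)) * \<P>(\<omega> in M. drawn v k \<omega> = h))"
    by (simp add: sum.cartesian_product[symmetric] sum_distrib_right sum_distrib_left mult_ac)
  also have "\<dots> = expectation (\<lambda>\<omega>. \<Sum>j=1..n. draw u n (drawn v k \<omega>) j * F (j # drawn v k \<omega>))"
    using assms by (subst expectation_drawn[of k "\<lambda>h. \<Sum>j=1..n. draw u n h j * F (j # h)"]) auto
  finally show ?thesis .
qed

lemma supermartingale:
  assumes "\<And>h. admissible n h \<Longrightarrow> length h < k \<Longrightarrow> (\<Sum>j=1..n. draw u n h j * Y (j # h)) \<le> Y h"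
    and "k \<le> n"
  shows "expectation (\<lambda>\<omega>. Y (drawn v k \<omega>)) \<le> (Y [] :: real)"
  using assms
proof (induction k)
  case (Suc k)
  have "expectation (\<lambda>\<omega>. Y (drawn v (Suc k) \<omega>)) \<le> expectation (\<lambda>\<omega>. Y (drawn v k \<omega>))"
    unfolding expectation_drawn_Suc[OF Suc_le_lessD[OF Suc.prems(2)]]
  proof (rule integral_mono)
    show "integrable M (\<lambda>\<omega>. \<Sum>j=1..n. draw u n (drawn v k \<omega>) j * Y (j # drawn v k \<omega>))"
      using Suc.prems(2) integrable_drawn[of k "\<lambda>h. \<Sum>j=1..n. draw u n h j * Y (j # h)"] by simp
    show "integrable M (\<lambda>\<omega>. Y (drawn v k \<omega>))"
      using Suc.prems(2) by (simp add: integrable_drawn)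
    fix \<omega> assume "\<omega> \<in> space M"
    then show "(\<Sum>j=1..n. draw u n (drawn v k \<omega>) j * Y (j # drawn v k \<omega>)) \<le> Y (drawn v k \<omega>)"
      using Suc.prems admissible_drawn[of \<omega> k] by simp
  qed
  also have "\<dots> \<le> Y []" using Suc by simp
  finally show ?case .
qed (simp add: prob_space)

end

section \<open>First passage on histories and Freedman's inequality\<close>

lemma excess_uminus: "excess u n (\<lambda>i. - g i) h = - excess u n g h"
  by (induction h) (simp_all add: excess_Cons sum_negf)

lemma drop_drawn: "i \<le> k \<Longrightarrow> drop i (drawn v k \<omega>) = drawn v (k - i) \<omega>"
proof (induction i arbitrary: k)
  case (Suc i)
  then show ?case by (cases k) auto
qed simp

lemma abs_le_exp_add_exp: "\<bar>z\<bar> \<le> exp z + exp (- z :: real)"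
  using exp_ge_add_one_self[of z] exp_ge_add_one_self[of "- z"] exp_gt_zero[of z] exp_gt_zero[of "- z"]
  by (smt (verit))

text \<open>Dropping the \<open>i\<close> newest entries recovers an earlier history, so having
  passed the level \<open>x\<close> is a property of the current history and no stopping time has to
  be introduced.\<close>

definition reaches :: "(nat list \<Rightarrow> real) \<Rightarrow> real \<Rightarrow> nat list \<Rightarrow> bool" where
  "reaches X x h \<longleftrightarrow> (\<exists>i\<le>length h. x \<le> X (drop i h))"

lemma reaches_Nil [simp]: "reaches X x [] \<longleftrightarrow> x \<le> X []"
  by (simp add: reaches_def)

lemma reaches_Cons [simp]: "reaches X x (j # h) \<longleftrightarrow> x \<le> X (j # h) \<or> reaches X x h"
proof -
  have "(\<exists>i\<le>Suc (length h). P i) \<longleftrightarrow> P 0 \<or> (\<exists>i\<le>length h. P (Suc i))" for P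
    by (metis Suc_le_mono le0 not0_implies_Suc)
  then show ?thesis by (simp add: reaches_def)
qed

lemma reaches_drawn: "reaches X x (drawn v k \<omega>) \<longleftrightarrow> (\<exists>i\<le>k. x \<le> X (drawn v i \<omega>))"
proof
  assume "reaches X x (drawn v k \<omega>)"
  then obtain i where "i \<le> k" "x \<le> X (drawn v (k - i) \<omega>)"
    by (auto simp: reaches_def drop_drawn)
  then show "\<exists>i\<le>k. x \<le> X (drawn v i \<omega>)" by (intro exI[of _ "k - i"]) auto
next
  assume "\<exists>i\<le>k. x \<le> X (drawn v i \<omega>)"
  then obtain i where "i \<le> k" "x \<le> X (drawn v i \<omega>)" by blast
  then show "reaches X x (drawn v k \<omega>)"
    unfolding reaches_def by (intro exI[of _ "k - i"]) (auto simp: drop_drawn)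
qed

context size_biased_sampling
begin

context
  fixes g :: "nat \<Rightarrow> real" and G V :: real and m :: nat
  assumes m: "m \<le> n" and G: "\<And>i. i \<in> {1..n} \<Longrightarrow> \<bar>g i\<bar> \<le> G" and V0: "0 \<le> V"
    and V: "\<And>h. admissible n h \<Longrightarrow> length h < m \<Longrightarrow> (\<Sum>i=1..n. draw u n h i * (g i)\<^sup>2) \<le> V"
begin

text \<open>The supermartingale property of exp(l X_k - l^2 V k), where X is the martingale part:
  the new factor is bounded by \<open>mgf_step\<close> and compensated by exp(- l^2 V).\<close>

lemma exp_step:
  assumes "admissible n h" "length h < m" "\<bar>l\<bar> * G \<le> 1"
  shows "(\<Sum>j=1..n. draw u n h j * exp (l * excess u n g (j # h) - l\<^sup>2 * V * length (j # h)))
    \<le> exp (l * excess u n g h - l\<^sup>2 * V * length h)"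
proof -
  have e: "exp (l * excess u n g (j # h) - l\<^sup>2 * V * length (j # h)) =
      exp (l * excess u n g h - l\<^sup>2 * V * length h) * exp (- (l\<^sup>2 * V)) *
      exp (l * (g j - (\<Sum>i=1..n. draw u n h i * g i)))" for j
    unfolding exp_add[symmetric] excess_Cons by (simp add: algebra_simps)
  have "(\<Sum>j=1..n. draw u n h j * exp (l * excess u n g (j # h) - l\<^sup>2 * V * length (j # h))) =
      exp (l * excess u n g h - l\<^sup>2 * V * length h) * exp (- (l\<^sup>2 * V)) *
      (\<Sum>j=1..n. draw u n h j * exp (l * (g j - (\<Sum>i=1..n. draw u n h i * g i))))"
    unfolding e sum_distrib_left by (intro sum.cong) auto
  also have "\<dots> \<le> exp (l * excess u n g h - l\<^sup>2 * V * length h) * exp (- (l\<^sup>2 * V)) * exp (l\<^sup>2 * V)"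
    using assms m pos G V by (intro mult_left_mono mgf_step) auto
  also have "\<dots> = exp (l * excess u n g h - l\<^sup>2 * V * length h)"
    by (simp add: exp_minus)
  finally show ?thesis .
qed

lemma expectation_exp_excess:
  assumes "\<bar>l\<bar> * G \<le> 1" "k \<le> m"
  shows "expectation (\<lambda>\<omega>. exp (l * excess u n g (drawn v k \<omega>))) \<le> exp (l\<^sup>2 * V * k)"
proof -
  have "expectation (\<lambda>\<omega>. exp (l * excess u n g (drawn v k \<omega>) - l\<^sup>2 * V * length (drawn v k \<omega>)))
      \<le> exp (l * excess u n g [] - l\<^sup>2 * V * length ([] :: nat list))"
    using assms m by (intro supermartingale exp_step) auto
  then show ?thesis by (simp add: exp_diff divide_le_eq)
qed

text \<open>With \<open>l\<close> the inverse of G + sqrt(m V), both l G and l^2 m V are at most 1.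
  The exponential moments at \<open>l\<close> and \<open>- l\<close> are then at most e, hence at
  most 3, and together they dominate \<open>l\<close> times the absolute value.\<close>

lemma expectation_abs_excess:
  assumes "0 < G" "k \<le> m"
  shows "expectation (\<lambda>\<omega>. \<bar>excess u n g (drawn v k \<omega>)\<bar>) \<le> 6 * (G + sqrt (m * V))"
proof -
  let ?X = "\<lambda>\<omega>. excess u n g (drawn v k \<omega>)"
  define l where "l = 1 / (G + sqrt (m * V))"
  have d: "0 < G + sqrt (m * V)" using assms(1) V0 by (simp add: add_pos_nonneg)
  have l: "0 < l" "l * G \<le> 1" "l * sqrt (m * V) \<le> 1"
    using d assms(1) V0 by (auto simp: l_def divide_le_eq)
  have "(l * sqrt (m * V))\<^sup>2 \<le> 1" using l V0 by (intro power_le_one) auto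
  then have "l\<^sup>2 * V * m \<le> 1" using V0 by (simp add: power_mult_distrib mult_ac)
  moreover have "l\<^sup>2 * V * k \<le> l\<^sup>2 * V * m"
    using V0 assms(2) by (intro mult_left_mono) auto
  ultimately have "exp (l\<^sup>2 * V * k) \<le> 3"
    using exp_le by (meson exp_le_cancel_iff order_trans)
  then have e: "expectation (\<lambda>\<omega>. exp (l * ?X \<omega>)) \<le> 3" "expectation (\<lambda>\<omega>. exp (- l * ?X \<omega>)) \<le> 3"
    using expectation_exp_excess[of l k] expectation_exp_excess[of "- l" k] l assms(2) by auto
  have i: "integrable M (\<lambda>\<omega>. F (drawn v k \<omega>))" for F :: "nat list \<Rightarrow> real"
    using integrable_drawn[of k F] assms(2) m by simp
  have "l * expectation (\<lambda>\<omega>. \<bar>?X \<omega>\<bar>) = expectation (\<lambda>\<omega>. l * \<bar>?X \<omega>\<bar>)" by simp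
  also have "\<dots> \<le> expectation (\<lambda>\<omega>. exp (l * ?X \<omega>) + exp (- l * ?X \<omega>))"
    using l(1) abs_le_exp_add_exp[of "l * ?X _"]
    by (intro integral_mono i[of "\<lambda>h. l * \<bar>excess u n g h\<bar>"]
        i[of "\<lambda>h. exp (l * excess u n g h) + exp (- l * excess u n g h)"]) (simp add: abs_mult)
  also have "\<dots> = expectation (\<lambda>\<omega>. exp (l * ?X \<omega>)) + expectation (\<lambda>\<omega>. exp (- l * ?X \<omega>))"
    by (intro Bochner_Integration.integral_add i[of "\<lambda>h. exp (l * excess u n g h)"]
        i[of "\<lambda>h. exp (- l * excess u n g h)"])
  also have "\<dots> \<le> 6" using e by simp
  finally show ?thesis using d by (simp add: l_def divide_le_eq)
qed

text \<open>The exponential supermartingale is frozen on first passage of \<open>x\<close>, not at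
  its current value but at the constant \<open>C\<close>, a lower bound for it at any passage within
  \<open>m\<close> steps. Lowering the value preserves the supermartingale property, and Markov's
  inequality at \<open>C\<close> gives the claim.\<close>

lemma prob_excess_ge:
  assumes "0 \<le> l" "l * G \<le> 1"
  shows "\<P>(\<omega> in M. \<exists>k\<le>m. x \<le> excess u n g (drawn v k \<omega>)) \<le> exp (l\<^sup>2 * V * m - l * x)"
proof -
  let ?E = "\<lambda>h. exp (l * excess u n g h - l\<^sup>2 * V * length h)"
  let ?R = "reaches (excess u n g) x"
  define C where "C = exp (l * x - l\<^sup>2 * V * m)"
  define Y where "Y h = (if ?R h then C else ?E h)" for h
  have C: "C \<le> ?E h" if "x \<le> excess u n g h" "length h \<le> m" for h
    unfolding C_def exp_le_cancel_iff using that assms V0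
    by (intro diff_mono mult_left_mono) auto
  have "expectation (\<lambda>\<omega>. Y (drawn v m \<omega>)) \<le> Y []"
  proof (rule supermartingale[OF _ m])
    fix h assume h: "admissible n h" "length h < m"
    have nn: "0 \<le> draw u n h j" if "j \<in> {1..n}" for j
      using admissible_remaining_pos[of n h u] h m pos pos[OF that] by (simp add: draw_def)
    show "(\<Sum>j=1..n. draw u n h j * Y (j # h)) \<le> Y h"
    proof (cases "?R h")
      case True
      have "0 < (\<Sum>i=1..n. u i) - sum_list (map u h)"
        using admissible_remaining_pos[of n h u] h m pos by simp
      then have "(\<Sum>j=1..n. draw u n h j) = 1"
        using sum_draw[OF h(1), of u "\<lambda>_. 1"] by simp
      then show ?thesis using True by (simp add: Y_def sum_distrib_right[symmetric])
    next
      case False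
      have "(\<Sum>j=1..n. draw u n h j * Y (j # h)) \<le> (\<Sum>j=1..n. draw u n h j * ?E (j # h))"
        using False h C[of "_ # h"] by (intro sum_mono mult_left_mono nn) (auto simp: Y_def)
      also have "\<dots> \<le> ?E h" using h assms by (intro exp_step) auto
      finally show ?thesis using False by (simp add: Y_def)
    qed
  qed
  \<comment> \<open>If \<open>x\<close> is not positive, the empty history has already passed and
    \<open>Y []\<close> is \<open>C\<close>; this is still at most the initial value 1.\<close>
  also have "Y [] \<le> 1" using C[of "[]"] by (simp add: Y_def)
  finally have "expectation (\<lambda>\<omega>. Y (drawn v m \<omega>)) \<le> 1" .
  moreover have "C * \<P>(\<omega> in M. ?R (drawn v m \<omega>)) \<le> expectation (\<lambda>\<omega>. Y (drawn v m \<omega>))"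
  proof -
    have "C * \<P>(\<omega> in M. ?R (drawn v m \<omega>)) =
        expectation (\<lambda>\<omega>. C * indicator {\<omega> \<in> space M. ?R (drawn v m \<omega>)} \<omega>)"
      using drawn_event[OF m] by simp
    also have "\<dots> \<le> expectation (\<lambda>\<omega>. Y (drawn v m \<omega>))"
      using drawn_event[OF m, of ?R]
      by (intro integral_mono integrable_mult_right integrable_drawn m integrable_real_indicator)
        (auto simp: Y_def C_def emeasure_eq_measure split: split_indicator)
    finally show ?thesis .
  qed
  ultimately have "C * \<P>(\<omega> in M. ?R (drawn v m \<omega>)) \<le> 1" by simp
  then have "\<P>(\<omega> in M. ?R (drawn v m \<omega>)) \<le> 1 / C"
    by (simp add: C_def field_simps)
  also have "1 / C = exp (l\<^sup>2 * V * m - l * x)"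
    unfolding C_def by (simp add: exp_minus[symmetric] divide_inverse)
  finally show ?thesis by (simp add: reaches_drawn)
qed

lemma prob_excess_ge_Bernstein:
  assumes "0 < G" "0 < x"
  shows "\<P>(\<omega> in M. \<exists>k\<le>m. x \<le> excess u n g (drawn v k \<omega>)) \<le> exp (- x\<^sup>2 / (4 * (m * V + G * x)))"
proof -
  \<comment> \<open>The quadratic term l^2 m V uses up at most half of l x, and the jump condition l
    G \<le> 1 holds automatically.\<close>
  define l where "l = x / (2 * (m * V + G * x))"
  have d: "0 < m * V + G * x" using assms V0 by (simp add: add_nonneg_pos)
  have l: "0 \<le> l" "l * G \<le> 1"
    using d assms V0 by (auto simp: l_def divide_le_eq mult.commute)
  have "l * (m * V) \<le> x / 2"
    using d assms V0 by (simp add: l_def field_simps)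
  then have "l * (l * (m * V)) \<le> l * (x / 2)" using l by (intro mult_left_mono)
  then have "l\<^sup>2 * V * m - l * x \<le> - (l * x / 2)"
    by (simp add: power2_eq_square algebra_simps)
  also have "l * x / 2 = x\<^sup>2 / (4 * (m * V + G * x))"
    by (simp add: l_def power2_eq_square)
  finally have "exp (l\<^sup>2 * V * m - l * x) \<le> exp (- x\<^sup>2 / (4 * (m * V + G * x)))" by simp
  with prob_excess_ge[OF l, of x] show ?thesis by linarith
qed

end

lemma prob_abs_excess_ge:
  assumes m: "m \<le> n" and G: "\<And>i. i \<in> {1..n} \<Longrightarrow> \<bar>g i\<bar> \<le> G" and V0: "0 \<le> V"
    and V: "\<And>h. admissible n h \<Longrightarrow> length h < m \<Longrightarrow> (\<Sum>i=1..n. draw u n h i * (g i)\<^sup>2) \<le> V"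
    and "0 < G" "0 < x"
  shows "\<P>(\<omega> in M. \<exists>k\<le>m. x \<le> \<bar>excess u n g (drawn v k \<omega>)\<bar>)
    \<le> 2 * exp (- x\<^sup>2 / (4 * (m * V + G * x)))"
proof -
  let ?A = "\<lambda>g. {\<omega> \<in> space M. \<exists>k\<le>m. x \<le> excess u n g (drawn v k \<omega>)}"
  have A: "?A g \<in> events" for g
    by (rule drawn_event[OF m, of "reaches (excess u n g) x", unfolded reaches_drawn])
  have "x \<le> \<bar>z\<bar> \<longleftrightarrow> x \<le> z \<or> x \<le> - z" for z :: real by arith
  then have eq: "{\<omega> \<in> space M. \<exists>k\<le>m. x \<le> \<bar>excess u n g (drawn v k \<omega>)\<bar>} = ?A g \<union> ?A (\<lambda>i. - g i)"
    by (auto simp: excess_uminus)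
  have "\<P>(\<omega> in M. \<exists>k\<le>m. x \<le> \<bar>excess u n g (drawn v k \<omega>)\<bar>) \<le> prob (?A g) + prob (?A (\<lambda>i. - g i))"
    unfolding eq by (rule measure_Un_le[OF A A])
  also have "\<dots> \<le> exp (- x\<^sup>2 / (4 * (m * V + G * x))) + exp (- x\<^sup>2 / (4 * (m * V + G * x)))"
    using assms by (intro add_mono prob_excess_ge_Bernstein) auto
  finally show ?thesis by simp
qed

end

subsection \<open>Comparison of the compensator with a deterministic center\<close>

lemma sum_sampled_weight:
  "(\<Sum>k=1..j. sampled_weight u v k \<omega>) = sum_list (map u (drawn v j \<omega>))"
  by (induction j) (simp_all add: sampled_weight_def)

lemma sum_sampled_weight_interval:
  assumes "i \<le> j"
  shows "(\<Sum>k=i..j. sampled_weight u v k \<omega>) =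
    sum_list (map u (drawn v j \<omega>)) - sum_list (map u (drawn v (i - 1) \<omega>))"
proof (cases "i = 0")
  \<comment> \<open>Truncated subtraction gives \<open>i - 1 = 0\<close>, and the term at index 0
    vanishes by convention, so the formula also holds here.\<close>
  case True
  then show ?thesis
    using sum_sampled_weight[where u = u and v = v and \<omega> = \<omega>]
    by (simp add: sum.atLeast_Suc_atMost sampled_weight_def)
next
  case False
  have "{1..j} = {1..i - 1} \<union> {i..j}" "{1..i - 1} \<inter> {i..j} = {}" using assms False by auto
  then have "(\<Sum>k=1..j. sampled_weight u v k \<omega>) =
      (\<Sum>k=1..i - 1. sampled_weight u v k \<omega>) + (\<Sum>k=i..j. sampled_weight u v k \<omega>)"
    by (metis finite_atLeastAtMost sum.union_disjoint)
  then show ?thesis by (simp only: sum_sampled_weight)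
qed

text \<open>From a/b - c/d = (a - c)/b - c (b - d)/(b d). In the applications \<open>b\<close> is
  the random remaining weight, known only through its lower bound \<open>e\<close>, and
  \<open>d\<close> is deterministic.\<close>

lemma abs_le_quotient:
  fixes a b c d :: real
  assumes "0 < e" "e \<le> b" "0 < d"
  shows "\<bar>a / b - c / d\<bar> \<le> \<bar>a - c\<bar> / e + \<bar>c\<bar> * \<bar>b - d\<bar> / (e * d)"
proof -
  have "a / b - c / d = (a - c) / b - c * (b - d) / (b * d)"
    using assms by (simp add: field_simps)
  also have "\<bar>\<dots>\<bar> \<le> \<bar>a - c\<bar> / b + \<bar>c\<bar> * \<bar>b - d\<bar> / (b * d)"
    using assms by (intro order_trans[OF abs_triangle_ineq4]) (simp add: abs_mult)
  also have "\<dots> \<le> \<bar>a - c\<bar> / e + \<bar>c\<bar> * \<bar>b - d\<bar> / (e * d)"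
    using assms by (intro add_mono divide_left_mono mult_right_mono) auto
  finally show ?thesis .
qed

text \<open>A non-asymptotic form of the hypotheses for one fixed \<open>n\<close>. The bound
  \<epsilon> \<le> c/2 keeps the remaining weight at least \<open>c * n / 2\<close> along every
  history of length at most \<open>m\<close>; \<open>2 * C * m \<le> c\<^sup>2 * n\<close> does the
  same for the denominators of \<open>center\<close>. \<open>small\<close> makes the drawn part of
  each power sum negligible, and \<open>tail\<close> the part carried by weights above n/m.\<close>

locale regular_sampling = size_biased_sampling +
  fixes m :: nat and b c C \<epsilon> :: real
  assumes m: "1 \<le> m" "m \<le> n" "2 * C * m \<le> c\<^sup>2 * n"
    and const: "0 < c" "c \<le> 1" "1 \<le> C" "0 \<le> \<epsilon>" "\<epsilon> \<le> c / 2"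
    and b: "0 < b" "\<And>i. i \<in> {1..n} \<Longrightarrow> u i \<le> b"
    and total: "c * n \<le> (\<Sum>i=1..n. u i)" "(\<Sum>i=1..n. u i ^ 2) \<le> C * n" "(\<Sum>i=1..n. u i ^ 3) \<le> C * n"
    and small: "\<And>I p. I \<subseteq> {1..n} \<Longrightarrow> card I \<le> m \<Longrightarrow> p \<in> {1, 2, 3} \<Longrightarrow> (\<Sum>i\<in>I. u i ^ p) \<le> \<epsilon> * n"
    and tail: "(\<Sum>i | i \<in> {1..n} \<and> n / m < u i. u i ^ 3) \<le> \<epsilon> * n"
begin

definition "W = (\<Sum>i=1..n. u i)"
definition "q = (\<Sum>i=1..n. u i ^ 2)"
definition "r = (\<Sum>i=1..n. u i ^ 3)"
text \<open>A common constant for all comparisons of drift quotients: their numerators are at most C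
  n and their denominators at least c n/2.\<close>

definition "D = 8 * C / c\<^sup>2"
definition "V = 2 * C / c"
text \<open>An upper bound for each weight that survives the truncation in
  \<open>tsq\<close>.\<close>

definition "L = min (n / m) b"

(* Truncating at n / m ensures L * m <= n, so that the squares have small jumps at the scale y n / m. *)
definition "tsq i = (if u i \<le> n / m then u i ^ 2 else 0)"

(* The compensator of the sampled weight with both fluctuating sums replaced by linear functions of i. *)
definition "center k = (\<Sum>i<k. (q - r / W * real i) / (W - q / W * real i))"

lemma n_pos: "0 < real n" using m by simp

lemma ell_pos: "0 < W" "c * n \<le> W"
  using total(1) less_le_trans[OF mult_pos_pos[OF const(1) n_pos] total(1)]
  by (simp_all only: W_def)

lemma u_nonneg: "i \<in> {1..n} \<Longrightarrow> 0 \<le> u i"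
  by (rule less_imp_le[OF pos])

lemma q_bounds: "0 \<le> q" "q \<le> C * n" and r_bounds: "0 \<le> r" "r \<le> C * n"
  using total u_nonneg by (auto simp: q_def r_def intro!: sum_nonneg zero_le_power)

lemma D_bounds: "8 \<le> D" "4 / c \<le> D" "4 * C / c\<^sup>2 \<le> D"
proof -
  have c2: "c\<^sup>2 \<le> c" "0 < c\<^sup>2" using const by (auto simp: power2_eq_square mult_left_le)
  show "8 \<le> D" using c2 const unfolding D_def by (simp add: le_divide_eq)
  have "4 * c\<^sup>2 \<le> 8 * C * c" using c2 const mult_mono[of 1 C "c\<^sup>2" c] by (simp; linarith)
  then show "4 / c \<le> D" using c2 const unfolding D_def by (simp add: field_simps)
  show "4 * C / c\<^sup>2 \<le> D" using c2 const unfolding D_def by (intro divide_right_mono) auto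
qed

lemma D_m: "D * m \<le> 4 * n"
  using m(3) const by (simp add: D_def field_simps)

lemma V_bounds: "2 \<le> V"
  using const by (simp add: V_def le_divide_eq)

lemma L_bounds: "0 < L" "L \<le> b" "L \<le> n / m"
  using b n_pos m by (auto simp: L_def)

context
  fixes h assumes h: "admissible n h" "length h \<le> m"
begin

lemma small_sum_list:
  "sum_list (map u h) \<in> {0..\<epsilon> * n}" "sum_list (map (\<lambda>i. u i ^ 2) h) \<in> {0..\<epsilon> * n}"
  "sum_list (map (\<lambda>i. u i ^ 3) h) \<in> {0..\<epsilon> * n}"
proof -
  have s: "set h \<subseteq> {1..n}" "card (set h) \<le> m"
    using h by (auto simp: admissible_def distinct_card)
  have "0 \<le> (\<Sum>i\<in>set h. u i ^ p)" for p
    using s u_nonneg by (intro sum_nonneg zero_le_power) blast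
  with small[OF s, of 1] small[OF s, of 2] small[OF s, of 3] this[of 1] this[of 2] this[of 3]
  show "sum_list (map u h) \<in> {0..\<epsilon> * n}" "sum_list (map (\<lambda>i. u i ^ 2) h) \<in> {0..\<epsilon> * n}"
    "sum_list (map (\<lambda>i. u i ^ 3) h) \<in> {0..\<epsilon> * n}"
    using h(1) by (simp_all add: admissible_sum_list)
qed

lemma remaining: "c * n / 2 \<le> W - sum_list (map u h)" "0 < c * n / 2"
proof -
  have "\<epsilon> * n \<le> c / 2 * n" using const by (intro mult_right_mono) auto
  then show "c * n / 2 \<le> W - sum_list (map u h)"
    using small_sum_list(1) ell_pos by auto
qed (use n_pos const in auto)

lemma draw_nonneg: "i \<in> {1..n} \<Longrightarrow> 0 \<le> draw u n h i"
  using remaining pos[of i] by (auto simp: draw_def W_def)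

lemma drift_weight: "(\<Sum>i=1..n. draw u n h i * u i) =
    (q - sum_list (map (\<lambda>i. u i ^ 2) h)) / (W - sum_list (map u h))"
  using sum_draw[OF h(1), of u u] by (simp add: q_def W_def power2_eq_square)

lemma variance_weight: "(\<Sum>i=1..n. draw u n h i * (u i)\<^sup>2) \<le> V"
proof -
  have "(\<Sum>i=1..n. draw u n h i * (u i)\<^sup>2) =
      (r - sum_list (map (\<lambda>i. u i ^ 3) h)) / (W - sum_list (map u h))"
    using sum_draw[OF h(1), of u "\<lambda>i. (u i)\<^sup>2"]
    by (simp add: r_def W_def power2_eq_square power3_eq_cube mult.assoc)
  also have "\<dots> \<le> (C * n) / (c * n / 2)"
    using remaining r_bounds small_sum_list(3) const by (intro frac_le) auto
  also have "\<dots> = V" using n_pos const by (simp add: V_def)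
  finally show ?thesis .
qed

text \<open>The conditional second moment of a squared weight would involve fifth powers. Truncation
  bounds one factor u^2 by L^2 and leaves the second moment of the weight itself, so cubes
  suffice.\<close>

lemma variance_tsq: "(\<Sum>i=1..n. draw u n h i * (tsq i)\<^sup>2) \<le> V * L\<^sup>2"
proof -
  have "(tsq i)\<^sup>2 \<le> L\<^sup>2 * (u i)\<^sup>2" if "i \<in> {1..n}" for i
  proof (cases "u i \<le> n / m")
    case True
    then have "u i \<le> L" using b(2)[OF that] by (simp add: L_def)
    then have "(u i)\<^sup>2 \<le> L\<^sup>2" using pos[OF that] by (intro power_mono) auto
    then show ?thesis using True mult_right_mono[of "(u i)\<^sup>2" "L\<^sup>2" "(u i)\<^sup>2"]
      by (simp add: tsq_def power2_eq_square[of "(u i)\<^sup>2"])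
  qed (simp add: tsq_def)
  then have "(\<Sum>i=1..n. draw u n h i * (tsq i)\<^sup>2) \<le> (\<Sum>i=1..n. draw u n h i * (L\<^sup>2 * (u i)\<^sup>2))"
    by (intro sum_mono mult_left_mono draw_nonneg)
  also have "\<dots> = L\<^sup>2 * (\<Sum>i=1..n. draw u n h i * (u i)\<^sup>2)"
    by (simp add: sum_distrib_left mult_ac)
  also have "\<dots> \<le> L\<^sup>2 * V" by (intro mult_left_mono variance_weight) simp
  finally show ?thesis by (simp add: mult.commute)
qed

text \<open>Numerator and denominator are both of order n, so perturbations of order \<epsilon> n
  change the quotient by O(\<epsilon>). The factor 2 leaves room for two errors in the numerator,
  from the drawn indices and from the truncation.\<close>

lemma const_drift:
  assumes "\<bar>a - z\<bar> \<le> 2 * \<epsilon> * n" "0 \<le> z" "z \<le> C * n"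
  shows "\<bar>a / (W - sum_list (map u h)) - z / W\<bar> \<le> D * \<epsilon>"
proof -
  have "\<bar>a / (W - sum_list (map u h)) - z / W\<bar> \<le>
      \<bar>a - z\<bar> / (c * n / 2) + \<bar>z\<bar> * \<bar>W - sum_list (map u h) - W\<bar> / ((c * n / 2) * W)"
    using remaining ell_pos by (intro abs_le_quotient) auto
  also have "\<dots> \<le> (2 * \<epsilon> * n) / (c * n / 2) + (C * n) * (\<epsilon> * n) / ((c * n / 2) * (c * n))"
    using small_sum_list(1) assms remaining(2) ell_pos const n_pos
    by (intro add_mono frac_le mult_mono) auto
  also have "\<dots> = \<epsilon> * (4 / c + 2 * C / c\<^sup>2)"
    using n_pos const by (simp add: field_simps power2_eq_square)
  finally have "\<bar>a / (W - sum_list (map u h)) - z / W\<bar> \<le> \<epsilon> * (4 / c + 2 * C / c\<^sup>2)" .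
  moreover have "\<epsilon> * (4 / c + 2 * C / c\<^sup>2) \<le> \<epsilon> * D"
  proof (intro mult_left_mono)
    have "4 * c \<le> 6 * C" using const by linarith
    then show "4 / c + 2 * C / c\<^sup>2 \<le> D" using const by (simp add: D_def field_simps power2_eq_square)
  qed (use const in simp)
  ultimately show ?thesis by (simp add: mult.commute)
qed

lemma drift_weight_const: "\<bar>(\<Sum>i=1..n. draw u n h i * u i) - q / W\<bar> \<le> D * \<epsilon>"
  unfolding drift_weight using small_sum_list(2) q_bounds by (intro const_drift) auto

lemma drift_tsq_const: "\<bar>(\<Sum>i=1..n. draw u n h i * tsq i) - r / W\<bar> \<le> D * \<epsilon>"
proof -
  have "(\<Sum>i=1..n. u i * tsq i) = (\<Sum>i | i \<in> {1..n} \<and> \<not> n / m < u i. u i ^ 3)"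
    by (rule sum.mono_neutral_cong_right) (auto simp: tsq_def power2_eq_square power3_eq_cube)
  moreover have "r = (\<Sum>i | i \<in> {1..n} \<and> n / m < u i. u i ^ 3) + (\<Sum>i | i \<in> {1..n} \<and> \<not> n / m < u i. u i ^ 3)"
    unfolding r_def by (subst sum.union_disjoint[symmetric]) (auto intro!: sum.cong)
  moreover have "0 \<le> (\<Sum>i | i \<in> {1..n} \<and> n / m < u i. u i ^ 3)"
    using pos by (intro sum_nonneg) (auto intro: less_imp_le)
  ultimately have 1: "\<bar>(\<Sum>i=1..n. u i * tsq i) - r\<bar> \<le> \<epsilon> * n"
    using tail by simp
  have i: "0 \<le> u i * tsq i \<and> u i * tsq i \<le> u i ^ 3" if "i \<in> set h" for i
    using that h pos[of i] by (auto simp: admissible_def tsq_def power2_eq_square power3_eq_cube)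
  have "sum_list (map (\<lambda>i. u i * tsq i) h) \<le> sum_list (map (\<lambda>i. u i ^ 3) h)"
    using i by (intro sum_list_mono) auto
  moreover have "0 \<le> sum_list (map (\<lambda>i. u i * tsq i) h)"
    using i by (intro sum_list_nonneg) auto
  ultimately have 2: "\<bar>sum_list (map (\<lambda>i. u i * tsq i) h)\<bar> \<le> \<epsilon> * n"
    using small_sum_list(3) by auto
  show ?thesis
    unfolding sum_draw[OF h(1)] W_def[symmetric]
    using 1 2 r_bounds by (intro const_drift) linarith+
qed

text \<open>The drift is a quotient of two quantities of order n, hence Lipschitz in the sums of
  drawn weights and of their squares with constant of order 1/n. The deterministic numerator is at
  most C n because what is subtracted from q lies between 0 and c n/2.\<close>

lemma drift_weight_center:
  "\<bar>(\<Sum>i=1..n. draw u n h i * u i) - (q - r / W * length h) / (W - q / W * length h)\<bar> \<le>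
    D / n * (\<bar>sum_list (map (\<lambda>i. u i ^ 2) h) - r / W * length h\<bar> +
      \<bar>sum_list (map u h) - q / W * length h\<bar>)"
proof -
  let ?k = "real (length h)"
  have bound: "z / W * ?k \<le> c * n / 2" if "0 \<le> z" "z \<le> C * n" for z
  proof -
    have "z / W * ?k \<le> (C * n) / (c * n) * m"
      using that ell_pos h(2) n_pos const by (intro mult_mono frac_le) auto
    also have "\<dots> = C * m / c" using n_pos const by simp
    also have "\<dots> \<le> c * n / 2" using m(3) const by (simp add: field_simps power2_eq_square)
    finally show ?thesis .
  qed
  have l: "c * n / 2 \<le> W - q / W * ?k" using bound[of q] q_bounds ell_pos by linarith
  have "0 \<le> r / W * ?k" using r_bounds ell_pos by simp
  moreover have "c * n / 2 \<le> C * n" using const n_pos by simp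
  ultimately have q: "\<bar>q - r / W * ?k\<bar> \<le> C * n"
    using bound[of r] r_bounds q_bounds by linarith
  let ?T = "sum_list (map (\<lambda>i. u i ^ 2) h)" and ?S = "sum_list (map u h)"
  have "\<bar>(q - ?T) / (W - ?S) - (q - r / W * ?k) / (W - q / W * ?k)\<bar> \<le>
      \<bar>(q - ?T) - (q - r / W * ?k)\<bar> / (c * n / 2) +
      \<bar>q - r / W * ?k\<bar> * \<bar>(W - ?S) - (W - q / W * ?k)\<bar> / ((c * n / 2) * (W - q / W * ?k))"
    using remaining l by (intro abs_le_quotient) auto
  also have "\<dots> \<le> \<bar>?T - r / W * ?k\<bar> / (c * n / 2) +
      (C * n) * \<bar>?S - q / W * ?k\<bar> / ((c * n / 2) * (c * n / 2))"
    using remaining(2) l q const n_pos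
    by (intro add_mono frac_le mult_mono) (auto simp: abs_minus_commute)
  also have "\<dots> = (2 / c) / n * \<bar>?T - r / W * ?k\<bar> + (4 * C / c\<^sup>2) / n * \<bar>?S - q / W * ?k\<bar>"
    using n_pos const by (simp add: field_simps power2_eq_square)
  also have "\<dots> \<le> D / n * \<bar>?T - r / W * ?k\<bar> + D / n * \<bar>?S - q / W * ?k\<bar>"
  proof -
    have "2 / c \<le> 4 / c" using const by (simp add: divide_right_mono)
    then have "2 / c \<le> D" using D_bounds(2) by linarith
    then show ?thesis
      using D_bounds n_pos by (intro add_mono mult_right_mono divide_right_mono) auto
  qed
  finally show ?thesis unfolding drift_weight by (simp add: distrib_left)
qed

end

section \<open>Pathwise and mean deviation from the deterministic center\<close>

lemma compensator_const:
  assumes h: "admissible n h" "length h \<le> m"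
    and g: "\<And>h. admissible n h \<Longrightarrow> length h \<le> m \<Longrightarrow> \<bar>(\<Sum>i=1..n. draw u n h i * g i) - z\<bar> \<le> D * \<epsilon>"
  shows "\<bar>compensator u n g h - z * length h\<bar> \<le> D * \<epsilon> * m"
proof -
  have "\<bar>compensator u n g h - z * length h\<bar> \<le> D * \<epsilon> * length h"
    using h
  proof (induction h)
    case (Cons j h)
    have h: "admissible n h" "length h \<le> m" using Cons.prems by (auto dest: admissible_ConsD)
    from Cons.IH[OF h] g[OF h] show ?case by (simp add: algebra_simps)
  qed simp
  also have "\<dots> \<le> D * \<epsilon> * m" using h D_bounds const by (intro mult_left_mono) auto
  finally show ?thesis .
qed

lemma weight_deviation:
  assumes h: "admissible n h" "length h \<le> m"
  shows "\<bar>sum_list (map u h) - q / W * length h\<bar> \<le> \<bar>excess u n u h\<bar> + D * \<epsilon> * m"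
  using compensator_const[OF h drift_weight_const] by (simp add: excess_def)

text \<open>A weight above n/m satisfies u^2 \<le> (m/n) u^3, so by \<open>tail\<close> the heavy
  squares contribute at most \<epsilon> m. The other error of order \<epsilon> m comes from
  replacing the compensator of the truncated squares by a linear function.\<close>

lemma square_deviation:
  assumes h: "admissible n h" "length h \<le> m"
  shows "\<bar>sum_list (map (\<lambda>i. u i ^ 2) h) - r / W * length h\<bar> \<le> \<bar>excess u n tsq h\<bar> + 2 * D * \<epsilon> * m"
proof -
  have s: "set h \<subseteq> {1..n}" using h by (simp add: admissible_def)
  have "sum_list (map (\<lambda>i. u i ^ 2) h) - sum_list (map tsq h) = (\<Sum>i\<in>set h. u i ^ 2 - tsq i)"
    using h by (simp add: admissible_sum_list sum_subtractf)
  also have "\<dots> = (\<Sum>i | i \<in> set h \<and> n / m < u i. u i ^ 2)"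
    by (rule sum.mono_neutral_cong_right) (auto simp: tsq_def)
  finally have eq: "sum_list (map (\<lambda>i. u i ^ 2) h) - sum_list (map tsq h) =
      (\<Sum>i | i \<in> set h \<and> n / m < u i. u i ^ 2)" .
  have "(\<Sum>i | i \<in> set h \<and> n / m < u i. u i ^ 2) \<le> (\<Sum>i | i \<in> {1..n} \<and> n / m < u i. u i ^ 2)"
    using s by (intro sum_mono2) auto
  also have "\<dots> \<le> (\<Sum>i | i \<in> {1..n} \<and> n / m < u i. m / n * u i ^ 3)"
  proof (intro sum_mono)
    fix i assume "i \<in> {i \<in> {1..n}. n / m < u i}"
    then have "1 * u i ^ 2 \<le> (m / n * u i) * u i ^ 2"
      using n_pos m by (intro mult_right_mono) (auto simp: field_simps)
    then show "u i ^ 2 \<le> m / n * u i ^ 3" by (simp add: power2_eq_square power3_eq_cube mult.assoc)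
  qed
  also have "\<dots> = m / n * (\<Sum>i | i \<in> {1..n} \<and> n / m < u i. u i ^ 3)"
    by (simp add: sum_distrib_left)
  also have "\<dots> \<le> m / n * (\<epsilon> * n)" by (intro mult_left_mono tail) simp
  also have "\<dots> = 1 * (\<epsilon> * m)" using n_pos by simp
  also have "\<dots> \<le> D * (\<epsilon> * m)" using D_bounds const by (intro mult_right_mono) auto
  finally have "(\<Sum>i | i \<in> set h \<and> n / m < u i. u i ^ 2) \<le> D * \<epsilon> * m" by (simp add: mult.assoc)
  moreover have "0 \<le> (\<Sum>i | i \<in> set h \<and> n / m < u i. u i ^ 2)" by (intro sum_nonneg) auto
  moreover have "\<bar>compensator u n tsq h - r / W * length h\<bar> \<le> D * \<epsilon> * m"
    by (rule compensator_const[OF h drift_tsq_const])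
  ultimately show ?thesis using eq by (simp add: excess_def)
qed

text \<open>Summing the drift comparison along the path bounds the compensator error by the two
  martingales at earlier times. The term \<open>3 * D * \<epsilon> * m\<close> collects one error
  from the weights and two from their squares.\<close>

lemma drawn_deviation:
  assumes "\<omega> \<in> space M" "k \<le> m"
  shows "\<bar>sum_list (map u (drawn v k \<omega>)) - center k\<bar> \<le> \<bar>excess u n u (drawn v k \<omega>)\<bar> +
    (\<Sum>i<k. D / n * (\<bar>excess u n tsq (drawn v i \<omega>)\<bar> + \<bar>excess u n u (drawn v i \<omega>)\<bar> + 3 * D * \<epsilon> * m))"
proof -
  have "\<bar>compensator u n u (drawn v k \<omega>) - center k\<bar> \<le>
    (\<Sum>i<k. D / n * (\<bar>excess u n tsq (drawn v i \<omega>)\<bar> + \<bar>excess u n u (drawn v i \<omega>)\<bar> + 3 * D * \<epsilon> * m))"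
    using assms(2)
  proof (induction k)
    case (Suc k)
    have h: "admissible n (drawn v k \<omega>)" "length (drawn v k \<omega>) \<le> m"
      using Suc.prems m by (auto intro: admissible_drawn assms(1))
    have "D / n * (\<bar>sum_list (map (\<lambda>i. u i ^ 2) (drawn v k \<omega>)) - r / W * length (drawn v k \<omega>)\<bar> +
        \<bar>sum_list (map u (drawn v k \<omega>)) - q / W * length (drawn v k \<omega>)\<bar>) \<le>
      D / n * (\<bar>excess u n tsq (drawn v k \<omega>)\<bar> + \<bar>excess u n u (drawn v k \<omega>)\<bar> + 3 * D * \<epsilon> * m)"
      using weight_deviation[OF h] square_deviation[OF h] D_bounds
      by (intro mult_left_mono) auto
    moreover have "\<bar>compensator u n u (drawn v k \<omega>) - center k\<bar> \<le>
        (\<Sum>i<k. D / n * (\<bar>excess u n tsq (drawn v i \<omega>)\<bar> + \<bar>excess u n u (drawn v i \<omega>)\<bar> + 3 * D * \<epsilon> * m))"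
      using Suc by simp
    moreover note drift_weight_center[OF h]
    moreover have "center (Suc k) = center k + (q - r / W * k) / (W - q / W * k)"
      by (simp add: center_def)
    ultimately show ?case
      unfolding drawn_Suc compensator.simps sum.lessThan_Suc length_drawn by linarith
  qed (simp add: center_def)
  then show ?thesis by (simp add: excess_def)
qed

lemma drawn_deviation_uniform:
  assumes "\<omega> \<in> space M" "k \<le> m"
    and "\<And>i. i \<le> m \<Longrightarrow> \<bar>excess u n u (drawn v i \<omega>)\<bar> \<le> x" "\<And>i. i \<le> m \<Longrightarrow> \<bar>excess u n tsq (drawn v i \<omega>)\<bar> \<le> z"
  shows "\<bar>sum_list (map u (drawn v k \<omega>)) - center k\<bar> \<le> x + D * m / n * (z + x + 3 * D * \<epsilon> * m)"
proof -
  have x: "0 \<le> x" "0 \<le> z" using assms(3)[of 0] assms(4)[of 0] by auto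
  have "\<bar>sum_list (map u (drawn v k \<omega>)) - center k\<bar> \<le> x + (\<Sum>i<k. D / n * (z + x + 3 * D * \<epsilon> * m))"
    using assms(2) D_bounds
    by (intro order_trans[OF drawn_deviation[OF assms(1,2)]] add_mono sum_mono mult_left_mono assms order_refl) auto
  also have "(\<Sum>i<k. D / n * (z + x + 3 * D * \<epsilon> * m)) = k * (D / n * (z + x + 3 * D * \<epsilon> * m))"
    by simp
  also have "\<dots> \<le> m * (D / n * (z + x + 3 * D * \<epsilon> * m))"
    using assms(2) x D_bounds const by (intro mult_right_mono) auto
  finally show ?thesis by (simp add: mult_ac)
qed

text \<open>Integrating the pathwise bound controls the bias, the distance between the expectation
  and \<open>center\<close>, by first moments of the martingales.\<close>

lemma expectation_deviation:
  assumes "k \<le> m"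
    and "\<And>i. i \<le> m \<Longrightarrow> expectation (\<lambda>\<omega>. \<bar>excess u n u (drawn v i \<omega>)\<bar>) \<le> x"
    and "\<And>i. i \<le> m \<Longrightarrow> expectation (\<lambda>\<omega>. \<bar>excess u n tsq (drawn v i \<omega>)\<bar>) \<le> z"
  shows "\<bar>expectation (\<lambda>\<omega>. sum_list (map u (drawn v k \<omega>))) - center k\<bar> \<le> x + D * m / n * (z + x + 3 * D * \<epsilon> * m)"
proof -
  have int: "integrable M (\<lambda>\<omega>. F (drawn v i \<omega>))" if "i \<le> m" for i and F :: "nat list \<Rightarrow> real"
    using integrable_drawn[of i F] that m by simp
  have x: "0 \<le> x" "0 \<le> z" using assms(2)[of 0] assms(3)[of 0] by auto
  have i1: "integrable M (\<lambda>\<omega>. \<bar>excess u n u (drawn v i \<omega>)\<bar>)" if "i \<le> m" for i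
    using int[OF that, of "\<lambda>h. \<bar>excess u n u h\<bar>"] .
  have i2: "integrable M (\<lambda>\<omega>. \<bar>excess u n tsq (drawn v i \<omega>)\<bar>)" if "i \<le> m" for i
    using int[OF that, of "\<lambda>h. \<bar>excess u n tsq h\<bar>"] .
  have iS: "integrable M (\<lambda>\<omega>. sum_list (map u (drawn v k \<omega>)))"
    using int[OF assms(1), of "\<lambda>h. sum_list (map u h)"] .
  have "\<bar>expectation (\<lambda>\<omega>. sum_list (map u (drawn v k \<omega>))) - center k\<bar> =
      \<bar>expectation (\<lambda>\<omega>. sum_list (map u (drawn v k \<omega>)) - center k)\<bar>"
    using iS by (simp add: prob_space)
  also have "\<dots> \<le> expectation (\<lambda>\<omega>. \<bar>sum_list (map u (drawn v k \<omega>)) - center k\<bar>)"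
    by (rule integral_abs_bound)
  also have "\<dots> \<le> expectation (\<lambda>\<omega>. \<bar>excess u n u (drawn v k \<omega>)\<bar> +
    (\<Sum>i<k. D / n * (\<bar>excess u n tsq (drawn v i \<omega>)\<bar> + \<bar>excess u n u (drawn v i \<omega>)\<bar> + 3 * D * \<epsilon> * m)))"
    using assms(1) iS
    by (intro integral_mono drawn_deviation Bochner_Integration.integrable_add Bochner_Integration.integrable_sum
        integrable_mult_right integrable_abs Bochner_Integration.integrable_diff i1 i2) auto
  also have "\<dots> = expectation (\<lambda>\<omega>. \<bar>excess u n u (drawn v k \<omega>)\<bar>) +
    (\<Sum>i<k. D / n * (expectation (\<lambda>\<omega>. \<bar>excess u n tsq (drawn v i \<omega>)\<bar>) +
      expectation (\<lambda>\<omega>. \<bar>excess u n u (drawn v i \<omega>)\<bar>) + 3 * D * \<epsilon> * m))"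
  proof -
    have 1: "integrable M (\<lambda>\<omega>. \<bar>excess u n tsq (drawn v i \<omega>)\<bar> + \<bar>excess u n u (drawn v i \<omega>)\<bar> + 3 * D * \<epsilon> * m)"
      if "i \<le> m" for i
      using that by (intro Bochner_Integration.integrable_add i1 i2) auto
    have 2: "expectation (\<lambda>\<omega>. \<bar>excess u n tsq (drawn v i \<omega>)\<bar> + \<bar>excess u n u (drawn v i \<omega>)\<bar> + 3 * D * \<epsilon> * m) =
      expectation (\<lambda>\<omega>. \<bar>excess u n tsq (drawn v i \<omega>)\<bar>) +
      expectation (\<lambda>\<omega>. \<bar>excess u n u (drawn v i \<omega>)\<bar>) + 3 * D * \<epsilon> * m" if "i \<le> m" for i
      using i1[OF that] i2[OF that] by (simp add: prob_space)
    show ?thesis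
      using assms(1) i1 1 2
      by (subst Bochner_Integration.integral_add)
        (auto intro!: Bochner_Integration.integrable_sum integrable_mult_right
          simp: Bochner_Integration.integral_sum)
  qed
  also have "\<dots> \<le> x + (\<Sum>i<k. D / n * (z + x + 3 * D * \<epsilon> * m))"
    using assms(1) D_bounds by (intro add_mono sum_mono mult_left_mono assms order_refl) auto
  also have "(\<Sum>i<k. D / n * (z + x + 3 * D * \<epsilon> * m)) = k * (D / n * (z + x + 3 * D * \<epsilon> * m))"
    by simp
  also have "\<dots> \<le> m * (D / n * (z + x + 3 * D * \<epsilon> * m))"
    using assms(1) x D_bounds const by (intro mult_right_mono) auto
  finally show ?thesis by (simp add: mult_ac)
qed

section \<open>Tail bounds for the two martingales and for the sampled sums\<close>

text \<open>The level y/64 leaves room for a multiplication by D m/n, at most 4, when this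
  martingale enters the drift. The factor D^2 is kept so that the exponent agrees with the one for
  the truncated squares.\<close>

lemma prob_excess_weight:
  fixes y :: real
  assumes "0 < y"
  shows "\<P>(\<omega> in M. \<exists>k\<le>m. y / 64 \<le> \<bar>excess u n u (drawn v k \<omega>)\<bar>)
    \<le> 2 * exp (- y\<^sup>2 / (1024 * D\<^sup>2 * V * (y * b + m)))"
proof -
  have D2: "64 \<le> D\<^sup>2" using power_mono[of 8 D 2] D_bounds by simp
  have "4096 * (4 * (m * V + b * (y / 64))) \<le> 16384 * (V * (y * b + m))"
    using V_bounds assms b mult_right_mono[of 1 V "y * b"] by (simp add: algebra_simps)
  also have "\<dots> \<le> (1024 * D\<^sup>2) * (V * (y * b + m))"
    using D2 V_bounds assms b by (intro mult_right_mono) auto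
  finally have "y\<^sup>2 / (1024 * D\<^sup>2 * V * (y * b + m)) \<le> y\<^sup>2 / (4096 * (4 * (m * V + b * (y / 64))))"
    using V_bounds D_bounds assms b m
    by (intro divide_left_mono mult_pos_pos add_pos_pos) (auto simp: mult.assoc)
  also have "\<dots> = (y / 64)\<^sup>2 / (4 * (m * V + b * (y / 64)))"
    by (simp add: power_divide)
  finally have "exp (- (y / 64)\<^sup>2 / (4 * (m * V + b * (y / 64)))) \<le> exp (- y\<^sup>2 / (1024 * D\<^sup>2 * V * (y * b + m)))"
    by simp
  moreover have "\<P>(\<omega> in M. \<exists>k\<le>m. y / 64 \<le> \<bar>excess u n u (drawn v k \<omega>)\<bar>)
      \<le> 2 * exp (- (y / 64)\<^sup>2 / (4 * (m * V + b * (y / 64))))"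
    using assms V_bounds b u_nonneg m by (intro prob_abs_excess_ge variance_weight) auto
  ultimately show ?thesis by linarith
qed

lemma tsq_le: "i \<in> {1..n} \<Longrightarrow> \<bar>tsq i\<bar> \<le> L\<^sup>2"
  using b(2)[of i] u_nonneg[of i] by (auto simp: tsq_def L_def intro!: power_mono)

text \<open>The level is chosen to contribute y/16 after multiplication by D m/n. Since L m \<le> n,
  the variance and jump terms multiplied by m^2 are at most V (y b + m) n^2, so the exponent has the
  same scale as for the weights; 1024 is 4 times 16^2.\<close>

lemma prob_excess_tsq:
  fixes y :: real
  assumes "0 < y"
  shows "\<P>(\<omega> in M. \<exists>k\<le>m. y * n / (16 * D * m) \<le> \<bar>excess u n tsq (drawn v k \<omega>)\<bar>)
    \<le> 2 * exp (- y\<^sup>2 / (1024 * D\<^sup>2 * V * (y * b + m)))"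
proof -
  define x where "x = y * n / (16 * D * m)"
  have x: "0 < x" using assms n_pos D_bounds m by (simp add: x_def)
  have Lm: "L * m \<le> n" using L_bounds m by (simp add: le_divide_eq)
  have "(m * (V * L\<^sup>2) + L\<^sup>2 * x) * m\<^sup>2 = m * V * (L * m)\<^sup>2 + (L * m) * L * (y * n / (16 * D))"
    using D_bounds m by (simp add: x_def field_simps power2_eq_square)
  also have "\<dots> \<le> m * V * n\<^sup>2 + n * b * (y * n / 1)"
    using Lm L_bounds V_bounds D_bounds assms n_pos
    by (intro add_mono mult_left_mono mult_mono power_mono divide_left_mono) auto
  also have "\<dots> \<le> V * (y * b + m) * n\<^sup>2"
    using V_bounds assms b n_pos mult_right_mono[of 1 V "y * b * n\<^sup>2"]
    by (simp add: algebra_simps power2_eq_square)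
  finally have le: "(m * (V * L\<^sup>2) + L\<^sup>2 * x) * m\<^sup>2 \<le> V * (y * b + m) * n\<^sup>2" .
  have pos: "0 < m * (V * L\<^sup>2) + L\<^sup>2 * x" using m V_bounds L_bounds x by (intro add_pos_pos) auto
  have pos': "0 < V" "0 < y * b + m" using m V_bounds assms b by (auto intro: add_pos_pos)
  have "y\<^sup>2 / (1024 * D\<^sup>2 * V * (y * b + m)) = (x * m)\<^sup>2 / (4 * (V * (y * b + m) * n\<^sup>2))"
    using n_pos D_bounds m by (simp add: x_def power_mult_distrib power_divide)
  also have "\<dots> \<le> (x * m)\<^sup>2 / (4 * ((m * (V * L\<^sup>2) + L\<^sup>2 * x) * m\<^sup>2))"
    using le pos pos' n_pos m
    by (intro divide_left_mono mult_pos_pos mult_left_mono) auto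
  also have "\<dots> = x\<^sup>2 / (4 * (m * (V * L\<^sup>2) + L\<^sup>2 * x))"
    using m by (simp add: power_mult_distrib)
  finally have "exp (- x\<^sup>2 / (4 * (m * (V * L\<^sup>2) + L\<^sup>2 * x))) \<le> exp (- y\<^sup>2 / (1024 * D\<^sup>2 * V * (y * b + m)))"
    by simp
  moreover have "\<P>(\<omega> in M. \<exists>k\<le>m. x \<le> \<bar>excess u n tsq (drawn v k \<omega>)\<bar>)
      \<le> 2 * exp (- x\<^sup>2 / (4 * (m * (V * L\<^sup>2) + L\<^sup>2 * x)))"
    using V_bounds L_bounds x m by (intro prob_abs_excess_ge variance_tsq tsq_le) auto
  ultimately show ?thesis unfolding x_def by linarith
qed

text \<open>Both the expectation and, outside two rare events, the partial sum lie within y/4 of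
  \<open>center\<close>. The second hypothesis bounds the drift error by y/32, the third makes the
  first moments of the martingales small against y.\<close>

lemma prob_partial_sums:
  fixes y :: real
  assumes y: "0 < y" "96 * D\<^sup>2 * \<epsilon> * m\<^sup>2 \<le> y * n" "288 * D * (b + sqrt (m * V)) \<le> y"
  defines "S j \<omega> \<equiv> sum_list (map u (drawn v j \<omega>))"
  shows "\<P>(\<omega> in M. \<exists>j\<le>m. y / 2 \<le> \<bar>S j \<omega> - expectation (S j)\<bar>)
    \<le> 4 * exp (- y\<^sup>2 / (1024 * D\<^sup>2 * V * (y * b + m)))"
proof -
  define R where "R = b + sqrt (m * V)"
  have R: "0 < R" "288 * D * R \<le> y"
    using b V_bounds y by (auto simp: R_def intro: add_pos_nonneg)
  have Dm: "D * m / n \<le> 4" using D_m n_pos by (simp add: divide_le_eq)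
  have bias: "D * m / n * (3 * D * \<epsilon> * m) \<le> y / 32"
    using y(2) n_pos by (simp add: field_simps power2_eq_square)
  have expect: "\<bar>expectation (S j) - center j\<bar> \<le> y / 4" if "j \<le> m" for j
  proof -
    have e1: "expectation (\<lambda>\<omega>. \<bar>excess u n u (drawn v i \<omega>)\<bar>) \<le> 6 * R" if "i \<le> m" for i
      using that m b u_nonneg V_bounds unfolding R_def
      by (intro expectation_abs_excess[where m = m] variance_weight) auto
    have e2: "expectation (\<lambda>\<omega>. \<bar>excess u n tsq (drawn v i \<omega>)\<bar>) \<le> 6 * (L\<^sup>2 + sqrt (m * (V * L\<^sup>2)))"
      if "i \<le> m" for i
      using that m V_bounds L_bounds
      by (intro expectation_abs_excess[where m = m] variance_tsq tsq_le) auto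
    \<comment> \<open>Since L m/n \<le> 1, the squares martingale scaled by m/n has a first moment
      of the same order as the weight martingale.\<close>
    have "m / n * (L\<^sup>2 + sqrt (m * (V * L\<^sup>2))) = (L * m / n) * (L + sqrt (m * V))"
      using L_bounds by (simp add: real_sqrt_mult power2_eq_square algebra_simps)
    also have "\<dots> \<le> 1 * (b + sqrt (m * V))"
      using L_bounds n_pos m V_bounds by (intro mult_mono add_mono) (auto simp: field_simps)
    finally have "D * (6 * (m / n * (L\<^sup>2 + sqrt (m * (V * L\<^sup>2))))) \<le> D * (6 * R)"
      unfolding R_def using D_bounds by (intro mult_left_mono) auto
    then have "D * m / n * (6 * (L\<^sup>2 + sqrt (m * (V * L\<^sup>2)))) \<le> 6 * (D * R)"
      by (simp add: mult_ac)
    moreover have "D * m / n * (6 * R) \<le> 24 * R"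
      using mult_right_mono[OF Dm, of "6 * R"] R by simp
    moreover have "\<bar>expectation (S j) - center j\<bar> \<le>
        6 * R + D * m / n * (6 * (L\<^sup>2 + sqrt (m * (V * L\<^sup>2))) + 6 * R + 3 * D * \<epsilon> * m)"
      unfolding S_def by (intro expectation_deviation that e1 e2)
    moreover have "8 * R \<le> D * R" using D_bounds R by (intro mult_right_mono) auto
    ultimately show ?thesis using bias R by (simp only: distrib_left)
  qed
  let ?A = "{\<omega> \<in> space M. \<exists>k\<le>m. y / 64 \<le> \<bar>excess u n u (drawn v k \<omega>)\<bar>}"
  let ?B = "{\<omega> \<in> space M. \<exists>k\<le>m. y * n / (16 * D * m) \<le> \<bar>excess u n tsq (drawn v k \<omega>)\<bar>}"
  have ev: "{\<omega> \<in> space M. \<exists>k\<le>m. x \<le> \<bar>F (drawn v k \<omega>)\<bar>} \<in> events" for x :: real and F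
    by (rule drawn_event[OF m(2), of "reaches (\<lambda>h. \<bar>F h\<bar>) x", unfolded reaches_drawn])
  have "{\<omega> \<in> space M. \<exists>j\<le>m. y / 2 \<le> \<bar>S j \<omega> - expectation (S j)\<bar>} \<subseteq> ?A \<union> ?B"
  proof (rule subsetI, rule ccontr)
    fix \<omega> assume "\<omega> \<in> {\<omega> \<in> space M. \<exists>j\<le>m. y / 2 \<le> \<bar>S j \<omega> - expectation (S j)\<bar>}" and no: "\<omega> \<notin> ?A \<union> ?B"
    then obtain j where j: "\<omega> \<in> space M" "j \<le> m" "y / 2 \<le> \<bar>S j \<omega> - expectation (S j)\<bar>" by blast
    have "\<bar>S j \<omega> - center j\<bar> \<le> y / 64 + D * m / n * (y * n / (16 * D * m) + y / 64 + 3 * D * \<epsilon> * m)"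
      unfolding S_def using no j(1) by (intro drawn_deviation_uniform j) (blast intro: linear[THEN disjE])+
    moreover have "D * m / n * (y * n / (16 * D * m)) = y / 16"
      using D_bounds n_pos m by simp
    moreover have "D * m / n * (y / 64) \<le> y / 16"
      using mult_right_mono[OF Dm, of "y / 64"] y by simp
    \<comment> \<open>The budget is y/64 + y/16 + y/16 + y/32 = 11 y/64, which is less than
      y/4.\<close>
    moreover have "t < y / 4" if "t \<le> y / 64 + K * (P + Q + B)" "K * P = y / 16" "K * Q \<le> y / 16" "K * B \<le> y / 32"
      for t K P Q B :: real
      using that y(1) unfolding distrib_left by linarith
    ultimately have "\<bar>S j \<omega> - center j\<bar> < y / 4" using bias by blast
    with expect[OF j(2)] j(3) show False by linarith
  qed
  then have "\<P>(\<omega> in M. \<exists>j\<le>m. y / 2 \<le> \<bar>S j \<omega> - expectation (S j)\<bar>) \<le> prob (?A \<union> ?B)"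
    by (intro finite_measure_mono sets.Un ev)
  also have "\<dots> \<le> prob ?A + prob ?B" by (intro measure_Un_le ev)
  also have "\<dots> \<le> 4 * exp (- y\<^sup>2 / (1024 * D\<^sup>2 * V * (y * b + m)))"
    using prob_excess_weight[OF y(1)] prob_excess_tsq[OF y(1)] by linarith
  finally show ?thesis .
qed

text \<open>A segment is the difference of two prefixes, so a deviation of \<open>y\<close> forces
  one of them to deviate by y/2. The supremum runs over a finite nonempty set and is
  attained.\<close>

lemma prob_segment_sums:
  fixes y :: real
  assumes y: "0 < y" "96 * D\<^sup>2 * \<epsilon> * m\<^sup>2 \<le> y * n" "288 * D * (b + sqrt (m * V)) \<le> y"
  shows "\<P>(\<omega> in M. (SUP (i, j) \<in> {(i, j). i \<le> j \<and> j \<le> m}.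
      \<bar>(\<Sum>k=i..j. sampled_weight u v k \<omega>) - expectation (\<lambda>\<omega>'. \<Sum>k=i..j. sampled_weight u v k \<omega>')\<bar>) \<ge> y)
    \<le> 4 * exp (- y\<^sup>2 / (1024 * D\<^sup>2 * V * (y * b + m)))"
proof -
  let ?I = "{(i, j). i \<le> j \<and> j \<le> m}"
  let ?S = "\<lambda>j \<omega>. sum_list (map u (drawn v j \<omega>))"
  let ?Z = "\<lambda>\<omega> (i, j). \<bar>(\<Sum>k=i..j. sampled_weight u v k \<omega>) - expectation (\<lambda>\<omega>'. \<Sum>k=i..j. sampled_weight u v k \<omega>')\<bar>"
  have fin: "finite ?I" "?I \<noteq> {}"
    by (auto intro: finite_subset[of _ "{..m} \<times> {..m}"])
  have "{\<omega> \<in> space M. y \<le> Sup (?Z \<omega> ` ?I)} \<subseteq>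
      {\<omega> \<in> space M. \<exists>j\<le>m. y / 2 \<le> \<bar>?S j \<omega> - expectation (?S j)\<bar>}"
  proof safe
    fix \<omega> assume \<omega>: "\<omega> \<in> space M" "y \<le> Sup (?Z \<omega> ` ?I)"
    have "Sup (?Z \<omega> ` ?I) = Max (?Z \<omega> ` ?I)" using fin by (intro cSup_eq_Max) auto
    also have "\<dots> \<in> ?Z \<omega> ` ?I" using fin by (intro Max_in) auto
    finally obtain i j where ij: "i \<le> j" "j \<le> m" "y \<le> ?Z \<omega> (i, j)" using \<omega>(2) by auto
    have int: "integrable M (?S k)" if "k \<le> m" for k
      using that m integrable_drawn[of k "\<lambda>h. sum_list (map u h)"] by simp
    have "?Z \<omega> (i, j) = \<bar>(?S j \<omega> - expectation (?S j)) - (?S (i - 1) \<omega> - expectation (?S (i - 1)))\<bar>"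
      using ij int by (simp add: sum_sampled_weight_interval)
    then have "y / 2 \<le> \<bar>?S j \<omega> - expectation (?S j)\<bar> \<or> y / 2 \<le> \<bar>?S (i - 1) \<omega> - expectation (?S (i - 1))\<bar>"
      using ij(3) by linarith
    then show "\<exists>j\<le>m. y / 2 \<le> \<bar>?S j \<omega> - expectation (?S j)\<bar>"
      using ij by (meson diff_le_self order_trans)
  qed
  moreover have "{\<omega> \<in> space M. \<exists>j\<le>m. y / 2 \<le> \<bar>?S j \<omega> - expectation (?S j)\<bar>} \<in> events"
    by (rule drawn_event[OF m(2), of "reaches (\<lambda>h. \<bar>sum_list (map u h) - expectation (?S (length h))\<bar>) (y / 2)",
          unfolded reaches_drawn length_drawn])
  ultimately have "\<P>(\<omega> in M. y \<le> Sup (?Z \<omega> ` ?I)) \<le>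
      \<P>(\<omega> in M. \<exists>j\<le>m. y / 2 \<le> \<bar>?S j \<omega> - expectation (?S j)\<bar>)"
    by (rule finite_measure_mono)
  with prob_partial_sums[OF y] show ?thesis by simp
qed

end

subsection \<open>Asymptotics of the weights\<close>

text \<open>Uniform integrability of the cubes: dominated convergence chooses \<open>K\<close> so
  that truncation costs little in the limit, weak convergence transfers this to the bounded
  continuous truncated cube, and convergence of the full third moment bounds the mass cut off. The
  maximum with 0 makes the test function bounded on the whole line.\<close>

lemma truncated_third_moment:
  fixes w :: "nat \<Rightarrow> nat \<Rightarrow> real" and \<delta> :: real
  assumes cond: "conditions1 w N W" and "0 < \<delta>"
  obtains K :: real where "0 < K"
    "\<forall>\<^sub>F n in sequentially. (\<Sum>i=1..n. w n i ^ 3 - min (max 0 (w n i) ^ 3) K) \<le> \<delta> * n"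
proof -
  have N: "prob_space N" and W: "W \<in> borel_measurable N" "AE x in N. 0 < W x"
    and conv: "weak_conv_m (\<lambda>n. distr (measure_pmf (pmf_of_set {1..n})) borel (w n)) (distr N borel W)"
    and int: "integrable N (\<lambda>x. W x ^ 3)"
    and third: "(\<lambda>n. (\<Sum>k=1..n. w n k ^ 3) - (\<integral>x. W x ^ 3 \<partial>N) * real n) \<in> o(\<lambda>n. 1)"
    using cond unfolding conditions1_def by blast+
  interpret N: prob_space N by (rule N)
  define E where "E = (\<integral>x. W x ^ 3 \<partial>N)"
  define h :: "real \<Rightarrow> real \<Rightarrow> real" where "h K x = min (max 0 x ^ 3) K" for K x
  have "(\<lambda>k. \<integral>x. h (real k) (W x) \<partial>N) \<longlonglongrightarrow> E"
    unfolding E_def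
  proof (rule integral_dominated_convergence[where w = "\<lambda>x. \<bar>W x ^ 3\<bar>"])
    show "AE x in N. (\<lambda>k. h (real k) (W x)) \<longlonglongrightarrow> W x ^ 3"
      using W(2)
    proof eventually_elim
      case (elim x)
      obtain k0 where "W x ^ 3 \<le> real k0" using real_arch_simple by blast
      then have "\<forall>k\<ge>k0. h (real k) (W x) = W x ^ 3"
        using elim by (auto simp: h_def min_def)
      then show ?case by (intro tendsto_eventually) (auto simp: eventually_sequentially)
    qed
    show "AE x in N. norm (h (real k) (W x)) \<le> \<bar>W x ^ 3\<bar>" for k
      using W(2) by eventually_elim (auto simp: h_def min_def)
  qed (use W int in \<open>auto simp: h_def\<close>)
  then have "\<forall>\<^sub>F k in sequentially. dist (\<integral>x. h (real k) (W x) \<partial>N) E < \<delta> / 2"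
    using assms(2) by (intro tendstoD) auto
  moreover have "\<forall>\<^sub>F k in sequentially. (0 :: nat) < k" by (rule eventually_gt_at_top)
  ultimately have "\<exists>k. dist (\<integral>x. h (real k) (W x) \<partial>N) E < \<delta> / 2 \<and> 0 < k"
    by (intro eventually_happens'[OF sequentially_bot] eventually_conj)
  then obtain k :: nat where k: "dist (\<integral>x. h (real k) (W x) \<partial>N) E < \<delta> / 2" "0 < k" by blast
  have meas: "h (real k) \<in> borel_measurable borel" by (simp add: h_def[abs_def])
  have "(\<lambda>n. integral\<^sup>L (distr (measure_pmf (pmf_of_set {1..n})) borel (w n)) (h (real k)))
      \<longlonglongrightarrow> integral\<^sup>L (distr N borel W) (h (real k))"
  proof (rule weak_conv_imp_integral_bdd_continuous_conv[OF _ _ conv])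
    show "real_distribution (distr (measure_pmf (pmf_of_set {1..n})) borel (w n))" for n
      by (rule prob_space.real_distribution_distr) (auto simp: measure_pmf.prob_space_axioms)
    show "real_distribution (distr N borel W)" using W by simp
    show "isCont (h (real k)) x" for x unfolding h_def by (intro continuous_intros)
    show "norm (h (real k) x) \<le> real k" for x by (simp add: h_def min_def)
  qed
  then have "(\<lambda>n. integral\<^sup>L (distr (measure_pmf (pmf_of_set {1..n})) borel (w n)) (h (real k)))
      \<longlonglongrightarrow> (\<integral>x. h (real k) (W x) \<partial>N)"
    using W meas by (simp add: integral_distr)
  then have "\<forall>\<^sub>F n in sequentially. dist (integral\<^sup>L (distr (measure_pmf (pmf_of_set {1..n})) borel (w n)) (h (real k)))
      (\<integral>x. h (real k) (W x) \<partial>N) < \<delta> / 4"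
    using assms(2) by (intro tendstoD) auto
  moreover have "\<forall>\<^sub>F n in sequentially. \<bar>(\<Sum>k=1..n. w n k ^ 3) - E * real n\<bar> \<le> \<delta> / 4"
    using landau_o.smallD[OF third, of "\<delta> / 4"] assms(2) by (simp add: E_def)
  ultimately have "\<forall>\<^sub>F n in sequentially. (\<Sum>i=1..n. w n i ^ 3 - h (real k) (w n i)) \<le> \<delta> * n"
    using eventually_ge_at_top[of 1]
  proof eventually_elim
    case (elim n)
    have "integral\<^sup>L (distr (measure_pmf (pmf_of_set {1..n})) borel (w n)) (h (real k)) =
        (\<Sum>i=1..n. h (real k) (w n i)) / n"
      using elim(3) meas by (simp add: integral_distr integral_pmf_of_set)
    then have "E - 3 * \<delta> / 4 \<le> (\<Sum>i=1..n. h (real k) (w n i)) / n"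
      using elim(1) k(1) unfolding dist_real_def by linarith
    then have "(E - 3 * \<delta> / 4) * n \<le> (\<Sum>i=1..n. h (real k) (w n i))"
      using elim(3) by (simp add: le_divide_eq)
    moreover have "\<delta> / 4 \<le> \<delta> / 4 * n" using elim(3) assms(2) by simp
    ultimately show ?case
      using abs_le_D1[OF elim(2)] by (simp add: sum_subtractf algebra_simps)
  qed
  then show thesis using k(2) by (intro that[of "real k"]) (auto simp: h_def)
qed

lemma expectation_pos:
  assumes "prob_space N" "AE x in N. 0 < f x" "integrable N f"
  shows "0 < (\<integral>x. f x \<partial>N :: real)"
proof -
  interpret prob_space N by fact
  have "0 \<le> (\<integral>x. f x \<partial>N)" using assms(2) by (intro integral_nonneg_AE) auto
  moreover have "(\<integral>x. f x \<partial>N) \<noteq> 0"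
  proof
    assume "(\<integral>x. f x \<partial>N) = 0"
    then have "AE x in N. f x = 0"
      using integral_nonneg_eq_0_iff_AE[OF assms(3)] AE_mp[OF assms(2), of "\<lambda>x. 0 \<le> f x"] by auto
    with assms(2) have "AE x in N. False" by eventually_elim simp
    then show False by simp
  qed
  ultimately show ?thesis by simp
qed

lemma eventually_power_sums:
  fixes w :: "nat \<Rightarrow> nat \<Rightarrow> real"
  assumes cond: "conditions1 w N W"
  obtains c C :: real where "0 < c" "c \<le> 1" "1 \<le> C"
    "\<forall>\<^sub>F n in sequentially. c * n \<le> total_weight w n \<and> total_weight w n \<le> C * n \<and>
      (\<Sum>i=1..n. w n i ^ 2) \<le> C * n \<and> (\<Sum>i=1..n. w n i ^ 3) \<le> C * n"
proof -
  define \<mu> where "\<mu> = (\<integral>x. W x \<partial>N)"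
  define \<rho> where "\<rho> = (\<integral>x. W x ^ 3 \<partial>N)"
  have N: "prob_space N" and W: "W \<in> borel_measurable N" "AE x in N. 0 < W x"
    and int: "integrable N (\<lambda>x. W x ^ 3)"
    using cond unfolding conditions1_def by blast+
  interpret N: prob_space N by (rule N)
  have "integrable N W"
  proof (rule Bochner_Integration.integrable_bound)
    show "integrable N (\<lambda>x. 1 + W x ^ 3)" using int by simp
    show "AE x in N. norm (W x) \<le> norm (1 + W x ^ 3)"
      using W(2)
    proof eventually_elim
      case (elim x)
      have "W x \<le> 1 + W x ^ 3"
        using elim power_increasing[of 1 3 "W x"] by (cases "W x \<le> 1") (auto intro: add_increasing2)
      then show ?case using elim by simp
    qed
  qed (use W in auto)
  then have \<mu>: "0 < \<mu>" unfolding \<mu>_def by (intro expectation_pos N W)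
  \<comment> \<open>As 2 c \<le> \<mu>, a deviation of c n still leaves the lower bound c n; as c
    \<le> 1, the summands 1 in \<open>C\<close> absorb the deviations from above.\<close>
  define c where "c = min 1 (\<mu> / 2)"
  define C where "C = max (\<mu> + 1) (\<rho> + 1)"
  have c: "0 < c" "c \<le> 1" using \<mu> by (auto simp: c_def)
  \<comment> \<open>The condition E[W^2] = E[W] lets \<mu> serve for the first and the second power
    sum.\<close>
  have o: "(\<lambda>n. total_weight w n - \<mu> * real n) \<in> o(\<lambda>n. real n powr (2/3))"
    "(\<lambda>n. (\<Sum>k=1..n. w n k ^ 2) - \<mu> * real n) \<in> o(\<lambda>n. real n powr (2/3))"
    "(\<lambda>n. (\<Sum>k=1..n. w n k ^ 3) - \<rho> * real n) \<in> o(\<lambda>n. 1)"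
    using cond unfolding conditions1_def \<mu>_def \<rho>_def by metis+
  have "\<forall>\<^sub>F n in sequentially. c * n \<le> total_weight w n \<and> total_weight w n \<le> C * n \<and>
      (\<Sum>i=1..n. w n i ^ 2) \<le> C * n \<and> (\<Sum>i=1..n. w n i ^ 3) \<le> C * n"
    using landau_o.smallD[OF o(1) c(1)] landau_o.smallD[OF o(2) c(1)] landau_o.smallD[OF o(3) zero_less_one]
      eventually_ge_at_top[of 1]
  proof eventually_elim
    case (elim n)
    have "real n powr (2/3) \<le> real n powr 1" using elim(4) by (intro powr_mono) auto
    then have "real n powr (2/3) \<le> n" using elim(4) by simp
    then have p: "c * real n powr (2/3) \<le> c * n" using c by (intro mult_left_mono) auto
    have cn: "2 * c * n \<le> \<mu> * n" "c * n \<le> 1 * real n" unfolding c_def by (intro mult_right_mono; simp)+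
    have Cn: "(\<mu> + 1) * n \<le> C * n" "(\<rho> + 1) * n \<le> C * n"
      unfolding C_def by (intro mult_right_mono; simp)+
    have dev: "\<bar>total_weight w n - \<mu> * n\<bar> \<le> c * n" "\<bar>(\<Sum>k=1..n. w n k ^ 2) - \<mu> * n\<bar> \<le> c * n"
      "\<bar>(\<Sum>k=1..n. w n k ^ 3) - \<rho> * n\<bar> \<le> 1"
      using elim(1-3) p by simp_all
    have "a \<le> T \<and> T \<le> z \<and> S \<le> z \<and> R \<le> z"
      if "\<bar>T - e\<bar> \<le> a" "\<bar>S - e\<bar> \<le> a" "\<bar>R - r\<bar> \<le> 1" "2 * a \<le> e" "a \<le> x" "e + x \<le> z" "r + x \<le> z" "1 \<le> x"
      for a e r x z T S R :: real
      using that by (simp add: abs_le_iff)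
    from this[OF dev, of n] show ?case
      using cn Cn elim(4) by (simp add: distrib_right mult.assoc)
  qed
  then show thesis using c \<mu> by (intro that[of c C]) (auto simp: C_def)
qed

(* Uniform integrability of the cubes makes the heavy weights, and any m = o(n) weights, negligible. *)
lemma eventually_regular:
  fixes w :: "nat \<Rightarrow> nat \<Rightarrow> real" and \<epsilon> :: real
  assumes "weights w" "conditions1 w N W" and \<epsilon>: "0 < \<epsilon>"
    and m: "(\<lambda>n. real (m n)) \<in> o(\<lambda>n. real n)"
  shows "\<forall>\<^sub>F n in sequentially. 1 \<le> m n \<longrightarrow>
    (\<forall>I\<subseteq>{1..n}. card I \<le> m n \<longrightarrow> (\<forall>p\<in>{1, 2, 3}. (\<Sum>i\<in>I. w n i ^ p) \<le> \<epsilon> * n)) \<and>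
    (\<Sum>i | i \<in> {1..n} \<and> n / m n < w n i. w n i ^ 3) \<le> \<epsilon> * n"
proof -
  obtain K where K: "0 < K"
    "\<forall>\<^sub>F n in sequentially. (\<Sum>i=1..n. w n i ^ 3 - min (max 0 (w n i) ^ 3) K) \<le> \<epsilon> / 2 * n"
    using truncated_third_moment[OF assms(2), of "\<epsilon> / 2"] \<epsilon> by auto
  \<comment> \<open>The first bound makes m (1 + K) at most \<epsilon> n/2. The second gives n/m
    \<ge> 1 + 2 K, so a weight above n/m has its cube at least 2 K, and the part of the cube beyond
    \<open>K\<close> is at least half of it.\<close>
  define \<kappa> where "\<kappa> = min (\<epsilon> / (2 * (1 + K))) (1 / (1 + 2 * K))"
  have \<kappa>: "0 < \<kappa>" using K \<epsilon> by (simp add: \<kappa>_def)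
  show ?thesis
    using K(2) landau_o.smallD[OF m \<kappa>] eventually_ge_at_top[of 1]
  proof eventually_elim
    case (elim n)
    let ?u = "w n" and ?m = "m n"
    let ?d = "\<lambda>i. ?u i ^ 3 - min (?u i ^ 3) K"
    have pos: "0 < ?u i" if "i \<in> {1..n}" for i
      using assms(1) elim(3) that by (auto simp: weights_def)
    have d: "0 \<le> ?d i" for i by simp
    have sum_d: "(\<Sum>i=1..n. ?d i) \<le> \<epsilon> / 2 * n"
    proof -
      have "(\<Sum>i=1..n. ?d i) = (\<Sum>i=1..n. ?u i ^ 3 - min (max 0 (?u i) ^ 3) K)"
        using pos by (intro sum.cong refl) (simp add: less_imp_le max_absorb2 max_def)
      then show ?thesis using elim(1) by simp
    qed
    have m\<kappa>: "?m \<le> \<kappa> * n" using elim(2) by simp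
    show ?case
    proof (intro impI conjI allI ballI)
      fix I p assume I: "I \<subseteq> {1..n}" "card I \<le> ?m" and p: "p \<in> {1, 2, 3 :: nat}"
      have fin: "finite I" using I finite_subset by blast
      \<comment> \<open>Powers up to the third are at most 1 plus the cube, and the cube is at most
        \<open>K\<close> plus its excess over \<open>K\<close>. The bounded part is controlled by
        the number of indices, the excess by its total over all of them.\<close>
      have "?u i ^ p \<le> (1 + K) + ?d i" if "i \<in> I" for i
      proof -
        have "0 < ?u i" using pos I(1) that by blast
        have "?u i ^ p \<le> 1 + ?u i ^ 3"
        proof (cases "?u i \<le> 1")
          case True
          then have "?u i ^ p \<le> 1" using \<open>0 < ?u i\<close> by (intro power_le_one) auto
          moreover have "0 \<le> ?u i ^ 3" using \<open>0 < ?u i\<close> by simp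
          ultimately show ?thesis by linarith
        next
          case False
          then have "?u i ^ p \<le> ?u i ^ 3" using p by (intro power_increasing) auto
          then show ?thesis by linarith
        qed
        also have "\<dots> \<le> (1 + K) + ?d i" by simp
        finally show ?thesis .
      qed
      then have "(\<Sum>i\<in>I. ?u i ^ p) \<le> (\<Sum>i\<in>I. (1 + K) + ?d i)" by (rule sum_mono)
      also have "\<dots> = card I * (1 + K) + (\<Sum>i\<in>I. ?d i)" by (simp only: sum.distrib sum_constant distrib_left)
      also have "(\<Sum>i\<in>I. ?d i) \<le> (\<Sum>i=1..n. ?d i)" using I by (intro sum_mono2 d) auto
      also have "card I * (1 + K) \<le> ?m * (1 + K)" using I(2) K by (intro mult_right_mono) auto
      also have "?m * (1 + K) \<le> \<kappa> * n * (1 + K)" using m\<kappa> K by (intro mult_right_mono) auto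
      also have "\<dots> \<le> \<epsilon> / (2 * (1 + K)) * n * (1 + K)"
        using K by (intro mult_right_mono) (auto simp: \<kappa>_def)
      also have "\<dots> = \<epsilon> / 2 * n" using K(1) by (simp add: field_simps)
      finally show "(\<Sum>i\<in>I. ?u i ^ p) \<le> \<epsilon> * n" using sum_d by simp
    next
      assume "1 \<le> ?m"
      have "(1 + 2 * K) * ?m \<le> (1 + 2 * K) * (1 / (1 + 2 * K) * n)"
        using m\<kappa> K by (intro mult_left_mono order_trans[OF m\<kappa>] mult_right_mono) (auto simp: \<kappa>_def)
      then have "(1 + 2 * K) * ?m \<le> n" using K by simp
      then have ratio: "1 + 2 * K \<le> n / ?m" using \<open>1 \<le> ?m\<close> by (simp add: le_divide_eq)
      have "(\<Sum>i | i \<in> {1..n} \<and> n / ?m < ?u i. ?u i ^ 3) \<le> (\<Sum>i | i \<in> {1..n} \<and> n / ?m < ?u i. 2 * ?d i)"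
      proof (rule sum_mono)
        fix i assume "i \<in> {i \<in> {1..n}. n / ?m < ?u i}"
        then have "1 + 2 * K \<le> ?u i" using ratio by simp
        moreover from this have "?u i \<le> ?u i ^ 3" using K power_increasing[of 1 3 "?u i"] by simp
        ultimately show "?u i ^ 3 \<le> 2 * ?d i" using K by (simp add: min_def)
      qed
      also have "\<dots> \<le> (\<Sum>i=1..n. 2 * ?d i)" by (intro sum_mono2) auto
      also have "\<dots> = 2 * (\<Sum>i=1..n. ?d i)" by (simp only: sum_distrib_left)
      finally show "(\<Sum>i | i \<in> {1..n} \<and> n / ?m < ?u i. ?u i ^ 3) \<le> \<epsilon> * n" using sum_d by simp
    qed
  qed
qed

section \<open>Choice of the constants and verification of the regularity hypotheses\<close>

theorem theorem20:
  fixes w :: "nat \<Rightarrow> nat \<Rightarrow> real"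
    and N :: "'b measure" and W :: "'b \<Rightarrow> real"
    and M :: "nat \<Rightarrow> 'a measure" and v :: "nat \<Rightarrow> nat \<Rightarrow> 'a \<Rightarrow> nat"
  assumes "weights w"
    and "conditions1 w N W"
    and "\<And>n. n \<ge> 1 \<Longrightarrow> size_biased_permutation (M n) (w n) n (v n)"
  shows "\<exists>A>0. \<exists>Abar>A. \<forall>(m :: nat \<Rightarrow> nat) (y :: nat \<Rightarrow> real).
    conditions2 w Abar (\<lambda>n. real (m n)) y \<longrightarrow>
    (\<forall>\<^sub>F n in sequentially.
      \<P>(\<omega> in M n.
        (SUP (i, j) \<in> {(i, j). i \<le> j \<and> j \<le> m n}.
          \<bar>(\<Sum>k=i..j. sampled_weight (w n) (v n) k \<omega>) -
           (\<integral>\<omega>'. (\<Sum>k=i..j. sampled_weight (w n) (v n) k \<omega>') \<partial>M n)\<bar>) \<ge> y n)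
      \<le> A * exp (- (y n)\<^sup>2 / (A * (y n * real n powr (1/3) + real (m n)))))"
proof -
  obtain c C :: real where c: "0 < c" "c \<le> 1" "1 \<le> C"
    and sums: "\<forall>\<^sub>F n in sequentially. c * n \<le> total_weight w n \<and> total_weight w n \<le> C * n \<and>
      (\<Sum>i=1..n. w n i ^ 2) \<le> C * n \<and> (\<Sum>i=1..n. w n i ^ 3) \<le> C * n"
    using eventually_power_sums[OF assms(2)] .
  define D where D_eq: "D = 8 * C / c\<^sup>2"
  define V where V_eq: "V = 2 * C / c"
  have "c\<^sup>2 \<le> 1" using c by (simp add: power_le_one)
  then have D: "8 \<le> D" using c by (simp add: D_eq le_divide_eq)
  have V: "2 \<le> V" using c by (simp add: V_eq le_divide_eq)
  define A where "A = 1024 * D\<^sup>2 * V"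
  \<comment> \<open>Chosen so that sqrt(Abar m) equals 576 D sqrt(m V), where 576 is twice the 288
    required by the segment bound. Neither \<open>A\<close> nor \<open>Abar\<close> involves
    \<epsilon>.\<close>
  define Abar where "Abar = (576 * D)\<^sup>2 * V"
  have DV: "64 * 2 \<le> D\<^sup>2 * V" using D V power_mono[of 8 D 2] by (intro mult_mono) auto
  moreover have "A = 1024 * (D\<^sup>2 * V)" "Abar = 331776 * (D\<^sup>2 * V)"
    by (simp_all add: A_def Abar_def power_mult_distrib)
  ultimately have A: "4 \<le> A" "A < Abar" by linarith+
  have "576 * D \<le> (576 * D)\<^sup>2" using D by (simp add: power2_eq_square)
  then have Abar: "576 * D \<le> Abar"
    using V mult_mono[of "576 * D" "(576 * D)\<^sup>2" 1 V] D by (simp add: Abar_def)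
  have max: "\<forall>\<^sub>F n in sequentially. \<forall>i\<in>{1..n}. w n i \<le> real n powr (1/3)"
  proof -
    have "(\<lambda>n. Max (w n ` {1..n})) \<in> o(\<lambda>n. real n powr (1/3))"
      using assms(2) by (simp add: conditions1_def)
    from landau_o.smallD[OF this zero_less_one] show ?thesis
      by eventually_elim (auto intro: order_trans[OF Max_ge] order_trans[OF abs_ge_self])
  qed
  have "\<forall>\<^sub>F n in sequentially.
      \<P>(\<omega> in M n.
        (SUP (i, j) \<in> {(i, j). i \<le> j \<and> j \<le> m n}.
          \<bar>(\<Sum>k=i..j. sampled_weight (w n) (v n) k \<omega>) -
           (\<integral>\<omega>'. (\<Sum>k=i..j. sampled_weight (w n) (v n) k \<omega>') \<partial>M n)\<bar>) \<ge> y n)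
      \<le> A * exp (- (y n)\<^sup>2 / (A * (y n * real n powr (1/3) + real (m n))))"
    if cond: "conditions2 w Abar (\<lambda>n. real (m n)) y" for m :: "nat \<Rightarrow> nat" and y :: "nat \<Rightarrow> real"
  proof -
    have pos: "\<And>n. n \<ge> 1 \<Longrightarrow> 0 < real (m n) \<and> 0 < y n"
      and exp: "\<forall>\<^sub>F n in sequentially. exp (- (y n)\<^sup>2 / (Abar * (y n * real n powr (1/3) + m n))) < 1/4"
      and small: "(\<lambda>n. real (m n)) \<in> o(\<lambda>n. real n)"
      and square: "(\<lambda>n. (real (m n))\<^sup>2) \<in> O(\<lambda>n. y n * total_weight w n)"
      using cond by (auto simp: conditions2_def)
    obtain B where B: "0 < B" "\<forall>\<^sub>F n in sequentially. (real (m n))\<^sup>2 \<le> B * \<bar>y n * total_weight w n\<bar>"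
      using landau_o.bigE[OF square] by (auto simp: abs_mult)
    \<comment> \<open>\<open>B\<close> depends on the sequences \<open>m\<close> and
      \<open>y\<close>, so \<epsilon> can only be chosen now. The second bound makes the drift
      error, of order \<epsilon> m^2/n, small against y through m^2 \<le> B y C n.\<close>
    define \<epsilon> where "\<epsilon> = min (c / 2) (1 / (96 * D\<^sup>2 * (B * C)))"
    define \<kappa> where "\<kappa> = min 1 (c\<^sup>2 / (2 * C))"
    have \<epsilon>: "0 < \<epsilon>" "\<epsilon> \<le> c / 2" "96 * D\<^sup>2 * (B * C) * \<epsilon> \<le> 1"
    proof -
      have "0 < 96 * D\<^sup>2 * (B * C)" using D B c by simp
      then show "0 < \<epsilon>" "\<epsilon> \<le> c / 2" "96 * D\<^sup>2 * (B * C) * \<epsilon> \<le> 1"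
        using c by (auto simp: \<epsilon>_def min_def field_simps)
    qed
    have \<kappa>: "0 < \<kappa>" using c by (simp add: \<kappa>_def)
    show ?thesis
      using exp B(2) sums max eventually_regular[OF assms(1,2) \<epsilon>(1) small] landau_o.smallD[OF small \<kappa>]
        eventually_ge_at_top[of 1]
    proof eventually_elim
      case (elim n)
      let ?b = "real n powr (1/3)"
      note p = pos[OF elim(7)]
      then have m1: "1 \<le> m n" by simp
      have b: "0 < ?b" using elim(7) by simp
      have m\<kappa>: "m n \<le> \<kappa> * n" using elim(6) by simp
      have \<kappa>n: "\<kappa> * n \<le> 1 * real n" "\<kappa> * n \<le> c\<^sup>2 / (2 * C) * n"
        unfolding \<kappa>_def by (intro mult_right_mono; simp)+
      have "2 * C * m n \<le> 2 * C * (c\<^sup>2 / (2 * C) * n)"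
        using m\<kappa> \<kappa>n(2) c by (intro mult_left_mono) auto
      moreover have "2 * C * (c\<^sup>2 / (2 * C) * n) = c\<^sup>2 * n" using c by simp
      ultimately have mn: "m n \<le> n" "2 * C * m n \<le> c\<^sup>2 * n" using m\<kappa> \<kappa>n(1) by linarith+
      interpret prob_space "M n"
        using assms(3)[OF elim(7)] by (simp add: size_biased_permutation_def)
      interpret regular_sampling "M n" "w n" n "v n" "m n" ?b c C \<epsilon>
        using assms(1) assms(3)[OF elim(7)] elim(3,4,5,7) m1 mn c \<epsilon> b
        by unfold_locales (auto simp: weights_def total_weight_def)
      \<comment> \<open>As 1/4 < 1/3 \<le> exp(-1), the exponential condition forces Abar (y n^(1/3)
        + m) \<le> y^2. Each of the two summands alone bounds one part of the left side by
        y/2.\<close>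
      have large: "288 * D * (?b + sqrt (m n * V)) \<le> y n"
      proof -
        let ?d = "y n * ?b + m n"
        have d: "0 < Abar * ?d" using p b A by (intro mult_pos_pos add_pos_pos) auto
        have "1 \<le> (y n)\<^sup>2 / (Abar * ?d)"
        proof (rule ccontr)
          assume "\<not> 1 \<le> (y n)\<^sup>2 / (Abar * ?d)"
          then have "exp (-1) \<le> exp (- (y n)\<^sup>2 / (Abar * ?d))" by simp
          moreover have "1 / 3 \<le> exp (- 1 :: real)" using exp_le by (simp add: exp_minus field_simps)
          ultimately show False using elim(1) by linarith
        qed
        then have le: "Abar * ?d \<le> (y n)\<^sup>2" using d by (simp add: le_divide_eq)
        have nn: "0 \<le> Abar * (y n * ?b)" "0 \<le> Abar * m n" using p b A by auto
        have "576 * D * ?b * y n \<le> Abar * ?b * y n" using Abar b p by (intro mult_right_mono) auto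
        also have "\<dots> \<le> y n * y n" using le nn by (simp add: algebra_simps power2_eq_square)
        finally have 1: "576 * D * ?b \<le> y n" using p by simp
        have "576 * D * sqrt (m n * V) = sqrt (Abar * m n)"
          using D by (simp add: Abar_def real_sqrt_mult mult_ac)
        also have "\<dots> \<le> sqrt ((y n)\<^sup>2)" using le nn by (intro real_sqrt_le_mono) (simp add: algebra_simps)
        also have "\<dots> = y n" using p by simp
        finally show ?thesis using 1 by (simp add: algebra_simps)
      qed
      have bias: "96 * D\<^sup>2 * \<epsilon> * (m n)\<^sup>2 \<le> y n * n"
      proof -
        have "0 < c * n" using elim(7) c by simp
        then have "0 < total_weight w n" using elim(3) by linarith
        then have "(real (m n))\<^sup>2 \<le> B * (y n * total_weight w n)" using elim(2) p by (simp add: abs_mult)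
        also have "\<dots> \<le> B * (y n * (C * n))" using elim(3) p B by (intro mult_left_mono) auto
        finally have "96 * D\<^sup>2 * \<epsilon> * (m n)\<^sup>2 \<le> 96 * D\<^sup>2 * \<epsilon> * (B * (y n * (C * n)))"
          using \<epsilon>(1) by (intro mult_left_mono) auto
        also have "\<dots> = (96 * D\<^sup>2 * (B * C) * \<epsilon>) * (y n * n)" by (simp add: mult_ac)
        also have "\<dots> \<le> 1 * (y n * n)" using \<epsilon>(3) p by (intro mult_right_mono) auto
        finally show ?thesis by simp
      qed
      have "4 * exp (- (y n)\<^sup>2 / (A * (y n * ?b + m n))) \<le> A * exp (- (y n)\<^sup>2 / (A * (y n * ?b + m n)))"
        using A by (intro mult_right_mono) auto
      moreover have "\<P>(\<omega> in M n.
        (SUP (i, j) \<in> {(i, j). i \<le> j \<and> j \<le> m n}.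
          \<bar>(\<Sum>k=i..j. sampled_weight (w n) (v n) k \<omega>) -
           (\<integral>\<omega>'. (\<Sum>k=i..j. sampled_weight (w n) (v n) k \<omega>') \<partial>M n)\<bar>) \<ge> y n)
        \<le> 4 * exp (- (y n)\<^sup>2 / (A * (y n * ?b + m n)))"
        unfolding A_def D_eq V_eq
        using p bias large unfolding D_eq V_eq
        by (intro prob_segment_sums[unfolded D_def V_def]) auto
      ultimately show ?case by linarith
    qed
  qed
  with A show ?thesis by (intro exI[of _ A] conjI exI[of _ Abar]) auto
qed

end
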